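(* Assume that $f_i$, $0\le i\le m$, are differentiable on $X$, that for some $M_1>0$, $M_2>0$ one has for $i=0,1,\dots,m$ and all $x\in X$ $$\mathbf{E}\Big[e^{(F_i(x,\xi)-f_i(x))^2/M_1^2}\Big]\le e,\qquad \mathbf{E}\Big[e^{L^2(x,\xi)/M_2^2}\Big]\le e ,$$ and that there exists $x\in X$ with $f_i(x)\le0$, $1\le i\le m$. Consider the minimax problem $$\mathrm{Opt}=\min_{x\in X}\max[f_1(x),\dots,f_m(x)]$$ and its Sample Average Approximation $$\mathrm{Opt}_N(\xi^N)=\min_{x\in X}\max[f_{1,N}(x,\xi^N),\dots,f_{m,N}(x,\xi^N)].$$ Then for every positive integer $N$, $s>1$ and $\lambda,\mu\in[0,2\sqrt{\tau_*N}]$ one has $$\mathrm{Prob}\left\{\mathrm{Opt}_N(\xi^N)>\mathrm{Opt}+\mu M_1N^{-1/2}\right\}\le m\,e^{-\frac{\mu^2}{4\tau_*}}$$ and $$\mathrm{Prob}\left\{\mathrm{Opt}_N(\xi^N)<\mathrm{Opt}-\left[\mu M_1+2M_2R\left[\tfrac{\Omega}{2}(1+s^2)+2\lambda\right]\right]N^{-1/2}\right\}\le e^{-\frac{\mu^2}{4\tau_*}}+2\left[e^{-N(s^2-1)}+e^{-\frac{\lambda^2}{4\tau_*}}\right].$$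
   Context: $E$ is a Euclidean space, $\|\cdot\|$ a norm on $E$ (not necessarily the Euclidean one), $B_{\|\cdot\|}$ its unit ball, and $\|y\|_*=\max_{\|x\|\le1}\langle x,y\rangle$ the conjugate norm. $\omega$ is a function continuously differentiable on $B_{\|\cdot\|}$, strongly convex with parameter one with respect to $\|\cdot\|$, i.e. $\langle\nabla\omega(x)-\nabla\omega(y),x-y\rangle\ge\|x-y\|^2$ for all $x,y\in B_{\|\cdot\|}$, and with $\omega(0)=0$, $\omega'(0)=0$. Set $\Omega=\max_{\|x\|\le1}\sqrt{2\omega(x)}$. $X\subset E$ is a nonempty convex compact set and $R$ is the smallest radius of a $\|\cdot\|$-ball containing $X$. $P$ is a Borel probability distribution on $\mathbf{R}^k$ with support $\Xi$, $\xi\sim P$. $F_i:E\times\Xi\to\mathbf{R}$, $0\le i\le m$, are Borel functions convex in $x$ and $P$-summable in $\xi$ for every $x$; $f_i(x)=\int_\Xi F_i(x,\xi)P(d\xi)$ (convex functions on $E$), and $$L(x,\xi)=\max_{0\le i\le m}\{\|g-h\|_*:\ g\in\partial_xF_i(x,\xi),\ h\in\partial f_i(x)\}.$$ $f_{i,N}(x,\xi^N)=\frac1N\sum_{t=1}^NF_i(x,\xi_t)$, where $\xi^N=(\xi_1,\dots,\xi_N)$ and $\xi_1,\xi_2,\dots$ are drawn independently from $P$. $\tau_*=0.557409\ldots$ is the smallest positive real such that $e^t\le t+e^{\tau_*t^2}$ for all $t\in\mathbf{R}$. *)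

theory Defs
  imports "HOL-Probability.Probability"
begin

(* Throughout, maxima and minima over infinite sets are written as SUP and INF; in the situation
   of the theorem they are taken over nonempty compact sets of continuous functions (or over
   compact sets of subgradients) and hence attained. *)

definition is_norm :: "('a::real_vector \<Rightarrow> real) \<Rightarrow> bool" where
  "is_norm nrm \<longleftrightarrow>
     (\<forall>x. nrm x = 0 \<longleftrightarrow> x = 0) \<and>
     (\<forall>c x. nrm (c *\<^sub>R x) = \<bar>c\<bar> * nrm x) \<and>
     (\<forall>x y. nrm (x + y) \<le> nrm x + nrm y)"

definition norm_ball :: "('a::real_vector \<Rightarrow> real) \<Rightarrow> 'a \<Rightarrow> real \<Rightarrow> 'a set" where
  "norm_ball nrm c r = {x. nrm (x - c) \<le> r}"

abbreviation unit_ball :: "('a::real_vector \<Rightarrow> real) \<Rightarrow> 'a set" where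
  "unit_ball nrm \<equiv> norm_ball nrm 0 1"

definition dual_norm :: "('a::euclidean_space \<Rightarrow> real) \<Rightarrow> 'a \<Rightarrow> real" where
  "dual_norm nrm y = (SUP x\<in>unit_ball nrm. inner x y)"

definition min_radius :: "('a::real_vector \<Rightarrow> real) \<Rightarrow> 'a set \<Rightarrow> real" where
  "min_radius nrm X = (LEAST r. \<exists>c. X \<subseteq> norm_ball nrm c r)"

definition Omega_const :: "('a::real_vector \<Rightarrow> real) \<Rightarrow> ('a \<Rightarrow> real) \<Rightarrow> real" where
  "Omega_const nrm \<omega> = (SUP x\<in>unit_ball nrm. sqrt (2 * \<omega> x))"

definition tau_star :: real where
  "tau_star = (LEAST \<tau>. 0 < \<tau> \<and> (\<forall>t::real. exp t \<le> t + exp (\<tau> * t\<^sup>2)))"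

definition msupport :: "'b::topological_space measure \<Rightarrow> 'b set" where
  "msupport P = {x. \<forall>U. open U \<longrightarrow> x \<in> U \<longrightarrow> emeasure P U > 0}"

definition subdiff :: "('a::real_inner \<Rightarrow> real) \<Rightarrow> 'a \<Rightarrow> 'a set" where
  "subdiff \<phi> x = {g. \<forall>y. \<phi> y \<ge> \<phi> x + inner g (y - x)}"

definition mean_fun ::
  "'b::topological_space measure \<Rightarrow> (nat \<Rightarrow> 'a \<Rightarrow> 'b \<Rightarrow> real) \<Rightarrow> nat \<Rightarrow> 'a \<Rightarrow> real" where
  "mean_fun P F i x = (LINT z:msupport P|P. F i x z)"

definition saa_fun ::
  "(nat \<Rightarrow> 'a \<Rightarrow> 'b \<Rightarrow> real) \<Rightarrow> nat \<Rightarrow> (nat \<Rightarrow> 'b) \<Rightarrow> nat \<Rightarrow> 'a \<Rightarrow> real" where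
  "saa_fun F N zs i x = (\<Sum>t=1..N. F i x (zs t)) / real N"

definition subgrad_dev ::
  "('a::euclidean_space \<Rightarrow> real) \<Rightarrow> 'b::topological_space measure \<Rightarrow>
   (nat \<Rightarrow> 'a \<Rightarrow> 'b \<Rightarrow> real) \<Rightarrow> nat \<Rightarrow> 'a \<Rightarrow> 'b \<Rightarrow> real" where
  "subgrad_dev nrm P F m x z =
     Sup {dual_norm nrm (g - h) | i g h.
            i \<le> m \<and> g \<in> subdiff (\<lambda>y. F i y z) x \<and> h \<in> subdiff (mean_fun P F i) x}"

definition minimax_value :: "'a set \<Rightarrow> nat \<Rightarrow> (nat \<Rightarrow> 'a \<Rightarrow> real) \<Rightarrow> real" where
  "minimax_value X m \<phi> = (INF x\<in>X. MAX i\<in>{1..m}. \<phi> i x)"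

end

theory Submission
  imports Defs
begin

text \<open>
  Both bounds come from looking at one minimiser \<open>xs\<close> of the true problem.

  The upper bound holds because \<open>OptN\<close> is at most the largest empirical mean at \<open>xs\<close>. Each empirical mean
  exceeds its expectation \<open>f i xs \<le> Opt\<close> by \<open>\<mu> M1 / sqrt N\<close> with probability at most
  \<open>exp (- \<mu>\<^sup>2 / (4 \<tau>))\<close>, where \<open>\<tau>\<close> is \<open>tau_star\<close>. This is a Chernoff bound:
  \<open>exp t \<le> t + exp (\<tau> t\<^sup>2)\<close> turns a zero mean and a bound on \<open>E exp (X\<^sup>2 / K\<^sup>2)\<close> into
  \<open>E exp (c X) \<le> exp (\<tau> c\<^sup>2 K\<^sup>2)\<close> whenever \<open>\<tau> c\<^sup>2 K\<^sup>2 \<le> 1\<close> (\<open>mgf_bound\<close>).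

  For the lower bound, optimality of \<open>xs\<close> provides weights \<open>y\<close> on the active constraints such that the
  gradient of the single convex function \<open>\<Sum>i. y i * f i\<close> is nonnegative in all feasible directions
  (\<open>minimax_multipliers\<close>). The sample average problem is bounded below by replacing the maximum by the
  \<open>y\<close>-average and then linearising each \<open>F i\<close> at \<open>xs\<close>. Two fluctuations remain: a scalar one, of the values
  at \<open>xs\<close>, handled as before, and a vector one, of the subgradients at \<open>xs\<close>. The latter acts on
  displacements of norm at most \<open>2 R\<close>, so only the dual norm of a sum of independent centred vectors matters.

  That dual norm is controlled by dual averaging (\<open>dual_averaging_regret\<close>). Playing
  \<open>V z = argmax (inner z u - \<omega> u)\<close> against the partial sums \<open>z\<close> of the vectors shows that the support
  function of the sum exceeds a martingale by at most \<open>\<Omega>\<^sup>2 / 2\<close> plus half the sum of the squared dual norms. The martingale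
  obeys the same Chernoff bound, now for summands that depend on the past through \<open>z\<close>
  (\<open>exp_adapted_sum_bound\<close>), and the sum of squares is bounded by Markov's inequality
  (\<open>dual_norm_sum_tail\<close>).

  The subgradients must be chosen measurably in the sample and have the gradient of the mean as their mean. Both
  follow from differentiability of the mean: it forces \<open>F i\<close> to be differentiable at \<open>xs\<close> for almost every
  sample, and the gradient is then a limit of difference quotients (\<open>AE_gradient\<close>).
\<close>

section \<open>Norms and their conjugates\<close>

lemma is_normD:
  assumes "is_norm nrm"
  shows "nrm x = 0 \<longleftrightarrow> x = 0" "nrm (c *\<^sub>R x) = \<bar>c\<bar> * nrm x" "nrm (x + y) \<le> nrm x + nrm y"
    "nrm 0 = 0" "nrm (- x) = nrm x" "nrm (x - y) \<le> nrm x + nrm y" "nrm (x - y) = nrm (y - x)"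
    "0 \<le> nrm x"
proof -
  show A: "nrm x = 0 \<longleftrightarrow> x = 0" "nrm (c *\<^sub>R x) = \<bar>c\<bar> * nrm x" "nrm (x + y) \<le> nrm x + nrm y"
    for x y c using assms by (auto simp: is_norm_def)
  show "nrm 0 = 0" using A(1)[of 0] by simp
  show B: "nrm (- x) = nrm x" for x using A(2)[of "-1" x] by simp
  show "nrm (x - y) \<le> nrm x + nrm y" using A(3)[of x "- y"] B by simp
  show "nrm (x - y) = nrm (y - x)" using B[of "x - y"] by simp
  show "0 \<le> nrm x" using A(3)[of x "- x"] B \<open>nrm 0 = 0\<close> by simp
qed

lemma is_norm_convex_on: "is_norm nrm \<Longrightarrow> convex_on UNIV nrm"
  unfolding convex_on_def
  using is_normD(2,3)
  by (smt (verit, ccfv_SIG) convex_UNIV)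

lemma is_norm_continuous:
  fixes nrm :: "'a::euclidean_space \<Rightarrow> real"
  assumes "is_norm nrm" shows "continuous_on S nrm"
  using convex_on_continuous[OF open_UNIV is_norm_convex_on[OF assms]] continuous_on_subset by blast

lemma is_norm_sum:
  assumes "is_norm nrm"
  shows "nrm (\<Sum>i\<in>I. v i) \<le> (\<Sum>i\<in>I. nrm (v i))"
proof (induction I rule: infinite_finite_induct)
  case (insert i I)
  then show ?case using is_normD(3)[OF assms, of "v i" "\<Sum>i\<in>I. v i"] by simp
qed (simp_all add: is_normD(4)[OF assms])

text \<open>
  A continuous norm attains a positive minimum on the Euclidean unit sphere, which is compact.
\<close>

lemma is_norm_ge_norm:
  fixes nrm :: "'a::euclidean_space \<Rightarrow> real"
  assumes "is_norm nrm"
  obtains k where "k > 0" "\<And>x. k * norm x \<le> nrm x"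
proof -
  have "sphere (0::'a) 1 \<noteq> {}" using vector_choose_size[of 1] by force
  then obtain x0 where x0: "x0 \<in> sphere 0 1" "\<And>y. y \<in> sphere 0 1 \<Longrightarrow> nrm x0 \<le> nrm y"
    using continuous_attains_inf[OF compact_sphere _ is_norm_continuous[OF assms]] by metis
  have pos: "nrm x0 > 0"
    using x0(1) is_normD(1,8)[OF assms, of x0] by (smt (verit) mem_sphere_0 norm_zero)
  have "nrm x0 * norm x \<le> nrm x" for x
  proof (cases "x = 0")
    case False
    have "nrm x0 \<le> nrm (x /\<^sub>R norm x)" using False by (intro x0) auto
    also have "\<dots> = nrm x / norm x" by (simp add: is_normD(2)[OF assms] divide_inverse mult.commute)
    finally show ?thesis using False by (simp add: field_simps)
  qed (simp add: is_normD(4)[OF assms])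
  then show ?thesis using that pos by blast
qed

lemma norm_ball_0: "norm_ball nrm 0 r = {x. nrm x \<le> r}"
  by (simp add: norm_ball_def)

lemma closed_norm_ball:
  fixes nrm :: "'a::euclidean_space \<Rightarrow> real"
  assumes "is_norm nrm" shows "closed (norm_ball nrm c r)"
  unfolding norm_ball_def
  by (intro closed_Collect_le continuous_on_const
      continuous_on_compose2[OF is_norm_continuous[OF assms, of UNIV]] continuous_intros) auto

lemma compact_unit_ball:
  fixes nrm :: "'a::euclidean_space \<Rightarrow> real"
  assumes "is_norm nrm" shows "compact (unit_ball nrm)"
proof -
  obtain k where k: "k > 0" "\<And>x. k * norm x \<le> nrm x" using is_norm_ge_norm[OF assms] by blast
  have "norm x \<le> 1 / k" if "nrm x \<le> 1" for x
    using k(2)[of x] that k(1) by (simp add: field_simps)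
  then have "bounded (unit_ball nrm)" by (auto simp: norm_ball_0 bounded_iff)
  with closed_norm_ball[OF assms] show ?thesis by (simp add: compact_eq_bounded_closed)
qed

lemma convex_unit_ball: 
  assumes "is_norm nrm" shows "convex (unit_ball nrm)"
proof -
  have "nrm (u *\<^sub>R x + v *\<^sub>R y) \<le> 1" if "nrm x \<le> 1" "nrm y \<le> 1" "0 \<le> u" "0 \<le> v" "u + v = 1" for x y u v
  proof -
    have "nrm (u *\<^sub>R x + v *\<^sub>R y) \<le> u * nrm x + v * nrm y"
      using is_normD(3)[OF assms, of "u *\<^sub>R x" "v *\<^sub>R y"] that by (simp add: is_normD(2)[OF assms])
    also have "\<dots> \<le> 1" using that by (simp add: convex_bound_le)
    finally show ?thesis .
  qed
  then show ?thesis by (auto simp: convex_def norm_ball_0)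
qed

lemma zero_in_unit_ball: "is_norm nrm \<Longrightarrow> 0 \<in> unit_ball nrm"
  by (simp add: norm_ball_0 is_normD)

lemma bdd_above_dual_norm:
  fixes nrm :: "'a::euclidean_space \<Rightarrow> real"
  assumes "is_norm nrm" shows "bdd_above ((\<lambda>x. inner x y) ` unit_ball nrm)"
  by (intro bounded_imp_bdd_above compact_imp_bounded compact_continuous_image
      compact_unit_ball assms continuous_intros)

lemma inner_le_dual_norm:
  fixes nrm :: "'a::euclidean_space \<Rightarrow> real"
  assumes "is_norm nrm" shows "inner x y \<le> nrm x * dual_norm nrm y"
proof (cases "x = 0")
  case False
  then have pos: "nrm x > 0" using is_normD(1,8)[OF assms] by (metis less_eq_real_def)
  have "inner (x /\<^sub>R nrm x) y \<le> dual_norm nrm y"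
    unfolding dual_norm_def using pos
    by (intro cSUP_upper bdd_above_dual_norm assms) (simp add: norm_ball_0 is_normD(2)[OF assms])
  then show ?thesis using pos by (simp add: field_simps)
qed (simp add: is_normD(4)[OF assms])

lemma dual_norm_least:
  fixes nrm :: "'a::euclidean_space \<Rightarrow> real"
  assumes "is_norm nrm" "\<And>x. nrm x \<le> 1 \<Longrightarrow> inner x y \<le> c" shows "dual_norm nrm y \<le> c"
  unfolding dual_norm_def using zero_in_unit_ball[OF assms(1)] assms
  by (intro cSUP_least) (auto simp: norm_ball_0)

lemma dual_norm_nonneg:
  fixes nrm :: "'a::euclidean_space \<Rightarrow> real"
  assumes "is_norm nrm" shows "0 \<le> dual_norm nrm y"
  unfolding dual_norm_def
  by (intro cSUP_upper2[OF bdd_above_dual_norm zero_in_unit_ball] assms) simp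

lemma is_norm_dual_norm:
  fixes nrm :: "'a::euclidean_space \<Rightarrow> real"
  assumes "is_norm nrm" shows "is_norm (dual_norm nrm)"
proof -
  note n = is_normD[OF assms] and le = inner_le_dual_norm[OF assms]
    and least = dual_norm_least[OF assms] and nn = dual_norm_nonneg[OF assms]
  have le1: "inner x y \<le> dual_norm nrm y" if "nrm x \<le> 1" for x y
    using le[of x y] that nn[of y] n(8)[of x] by (smt (verit) mult_left_le_one_le)
  have z: "dual_norm nrm x = 0 \<longleftrightarrow> x = 0" for x
  proof
    assume "dual_norm nrm x = 0"
    then have "inner x x \<le> 0" using le[of x x] by simp
    then show "x = 0" using inner_ge_zero[of x] inner_eq_zero_iff[of x] by linarith
  next
    assume "x = 0"
    then show "dual_norm nrm x = 0" using least[of 0 0] nn[of 0] by simp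
  qed
  have sc1: "dual_norm nrm (c *\<^sub>R x) \<le> \<bar>c\<bar> * dual_norm nrm x" for c x
  proof (rule least)
    fix u assume u: "nrm u \<le> 1"
    have "inner u (c *\<^sub>R x) = \<bar>c\<bar> * inner (sgn c *\<^sub>R u) x"
      by (simp add: sgn_real_def)
    also have "\<dots> \<le> \<bar>c\<bar> * dual_norm nrm x"
      using u n(8)[of u] by (intro mult_left_mono le1) (auto simp: sgn_real_def n(4,5))
    finally show "inner u (c *\<^sub>R x) \<le> \<bar>c\<bar> * dual_norm nrm x" .
  qed
  have "dual_norm nrm (c *\<^sub>R x) = \<bar>c\<bar> * dual_norm nrm x" for c x
  proof (cases "c = 0")
    case False
    have "dual_norm nrm (inverse c *\<^sub>R c *\<^sub>R x) \<le> \<bar>inverse c\<bar> * dual_norm nrm (c *\<^sub>R x)" by (rule sc1)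
    then have "\<bar>c\<bar> * dual_norm nrm x \<le> dual_norm nrm (c *\<^sub>R x)" using False by (simp add: field_simps)
    with sc1[of c x] show ?thesis by simp
  qed (use z[of 0] in simp)
  moreover have "dual_norm nrm (x + y) \<le> dual_norm nrm x + dual_norm nrm y" for x y
    by (rule least) (simp add: inner_add_right add_mono le1)
  ultimately show ?thesis using z by (simp add: is_norm_def)
qed

text \<open>
  The radius is a \<open>LEAST\<close> over the reals, so it means something only if it is attained.
  The pairs of the radius and the centre of an enclosing ball form a closed set, and bounding the
  radius also bounds the centre. The radius therefore attains its minimum on a compact set of such
  pairs.
\<close>

lemma min_radius_attained:
  fixes nrm :: "'a::euclidean_space \<Rightarrow> real"
  assumes nrm: "is_norm nrm" and X: "compact X" "X \<noteq> {}"
  obtains c where "X \<subseteq> norm_ball nrm c (min_radius nrm X)"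
proof -
  note n = is_normD[OF nrm]
  obtain k where k: "k > 0" "\<And>x. k * norm x \<le> nrm x" using is_norm_ge_norm[OF nrm] by blast
  obtain x0 where x0: "x0 \<in> X" using X by blast
  obtain r0 where r0: "\<And>x. x \<in> X \<Longrightarrow> nrm x \<le> r0"
    using continuous_attains_sup[OF X is_norm_continuous[OF nrm]] by metis
  \<comment> \<open>The cutoff \<open>r0\<close> is the radius of a ball around \<open>0\<close> that contains \<open>X\<close>, so the constraint set is nonempty.\<close>
  define K where "K = (\<Inter>x\<in>X. {p. fst p \<in> {0..r0} \<and> nrm (x - snd p) \<le> fst p})"
  have "0 \<le> r0" using r0[OF x0] n(8)[of x0] by linarith
  have ne: "(r0, 0) \<in> K" using r0 \<open>0 \<le> r0\<close> by (simp add: K_def)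
  have cl: "closed {p :: real \<times> 'a. fst p \<in> {0..r0} \<and> nrm (x - snd p) \<le> fst p}" for x
    unfolding atLeastAtMost_iff
    by (intro closed_Collect_conj closed_Collect_le continuous_intros
        continuous_on_compose2[OF is_norm_continuous[OF nrm, of UNIV]]) auto
  have "K \<subseteq> {0..r0} \<times> cball 0 ((nrm x0 + r0) / k)"
  proof safe
    fix a b assume "(a, b) \<in> K"
    then have ab: "a \<in> {0..r0}" "nrm (x0 - b) \<le> a" using x0 by (auto simp: K_def)
    have "nrm b \<le> nrm x0 + nrm (x0 - b)" using n(6)[of x0 "x0 - b"] by simp
    then have "k * norm b \<le> nrm x0 + r0" using k(2)[of b] ab by simp
    then show "b \<in> cball 0 ((nrm x0 + r0) / k)" using k(1) by (simp add: field_simps)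
    show "a \<in> {0..r0}" by fact
  qed
  then have "bounded K" using bounded_subset[OF bounded_Times[OF bounded_closed_interval bounded_cball]] by blast
  moreover have "closed K" unfolding K_def by (intro closed_INT ballI cl)
  ultimately have "compact K" by (simp add: compact_eq_bounded_closed)
  then obtain p where p: "p \<in> K" "\<And>q. q \<in> K \<Longrightarrow> fst p \<le> fst q"
    using continuous_attains_inf[of K fst] ne continuous_on_fst[OF continuous_on_id] by (metis empty_iff)
  have pX: "X \<subseteq> norm_ball nrm (snd p) (fst p)" using p(1) by (auto simp: K_def norm_ball_def)
  have "min_radius nrm X = fst p"
    unfolding min_radius_def
  proof (rule Least_equality)
    show "\<exists>c. X \<subseteq> norm_ball nrm c (fst p)" using pX by blast
  next
    fix r assume "\<exists>c. X \<subseteq> norm_ball nrm c r"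
    then obtain c where c: "X \<subseteq> norm_ball nrm c r" by blast
    show "fst p \<le> r"
    proof (cases "r \<le> r0")
      case True
      have "0 \<le> r" using c x0 n(8)[of "x0 - c"] by (force simp: norm_ball_def)
      then have "(r, c) \<in> K" using c True by (auto simp: K_def norm_ball_def)
      then show ?thesis using p(2) by force
    next
      case False
      then show ?thesis using p(2)[OF ne] by simp
    qed
  qed
  with pX show ?thesis using that by simp
qed

section \<open>Dual averaging with a strongly convex potential\<close>

text \<open>
  The mean value theorem along the segment from \<open>v\<close> to \<open>u\<close>, after
  subtracting the linear and the quadratic part: strong monotonicity of the gradient makes the
  derivative of the remainder nonnegative. Differentiability relative to the ball is enough, since
  the segment stays inside.
\<close>

lemma strongly_convex_gap:
  fixes nrm :: "'a::euclidean_space \<Rightarrow> real" and \<omega> :: "'a \<Rightarrow> real"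
  assumes nrm: "is_norm nrm"
    and deriv: "\<forall>x\<in>unit_ball nrm.
        (\<omega> has_derivative (\<lambda>d. inner (grad x) d)) (at x within unit_ball nrm)"
    and sc: "\<forall>x\<in>unit_ball nrm. \<forall>y\<in>unit_ball nrm.
        inner (grad x - grad y) (x - y) \<ge> (nrm (x - y))\<^sup>2"
    and uv: "u \<in> unit_ball nrm" "v \<in> unit_ball nrm"
  shows "\<omega> v + inner (grad v) (u - v) + (nrm (u - v))\<^sup>2 / 2 \<le> \<omega> u"
proof -
  define d where "d = u - v"
  define \<phi> where "\<phi> t = \<omega> (v + t *\<^sub>R d) - (t * inner (grad v) d + t\<^sup>2 / 2 * (nrm d)\<^sup>2)" for t :: real
  have seg: "v + t *\<^sub>R d \<in> unit_ball nrm" if "0 \<le> t" "t \<le> 1" for t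
  proof -
    have "v + t *\<^sub>R d = (1 - t) *\<^sub>R v + t *\<^sub>R u" by (simp add: d_def algebra_simps)
    then show ?thesis using convexD_alt[OF convex_unit_ball[OF nrm] uv(2,1) that] by simp
  qed
  have der: "(\<phi> has_derivative
      (\<lambda>h. h * (inner (grad (v + t *\<^sub>R d)) d - inner (grad v) d - t * (nrm d)\<^sup>2))) (at t within {0..1})"
    if t: "0 \<le> t" "t \<le> 1" for t
  proof -
    have "((\<lambda>t. \<omega> (v + t *\<^sub>R d)) has_derivative (\<lambda>h. inner (grad (v + t *\<^sub>R d)) (h *\<^sub>R d)))
        (at t within {0..1})"
    proof -
      have seg_der: "((\<lambda>t. v + t *\<^sub>R d) has_derivative (\<lambda>h. h *\<^sub>R d)) (at t within {0..1})"
        by (auto intro!: derivative_eq_intros)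
      have "(\<lambda>t. v + t *\<^sub>R d) ` {0..1} \<subseteq> unit_ball nrm" using seg by auto
      from has_derivative_in_compose[OF seg_der has_derivative_subset[OF deriv[rule_format, OF seg[OF t]] this]]
      show ?thesis .
    qed
    moreover have "((\<lambda>t. t * inner (grad v) d + t\<^sup>2 / 2 * (nrm d)\<^sup>2) has_derivative
        (\<lambda>h. h * (inner (grad v) d + t * (nrm d)\<^sup>2))) (at t within {0..1})"
      by (rule derivative_eq_intros refl | simp)+ (simp add: fun_eq_iff algebra_simps)
    ultimately show ?thesis unfolding \<phi>_def
      by (rule has_derivative_eq_rhs[OF has_derivative_diff]) (simp add: fun_eq_iff algebra_simps)
  qed
  obtain t where t: "t \<in> {0<..<1}"
    "\<phi> 1 - \<phi> 0 = (1 - 0) * (inner (grad (v + t *\<^sub>R d)) d - inner (grad v) d - t * (nrm d)\<^sup>2)"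
    using mvt_simple[OF zero_less_one der] by auto
  have "(nrm (t *\<^sub>R d))\<^sup>2 \<le> inner (grad (v + t *\<^sub>R d) - grad v) (t *\<^sub>R d)"
    using sc[rule_format, OF seg[of t] uv(2)] t(1) by simp
  then have "t * (t * (nrm d)\<^sup>2) \<le> t * (inner (grad (v + t *\<^sub>R d)) d - inner (grad v) d)"
    by (simp add: is_normD(2)[OF nrm] power_mult_distrib power2_eq_square inner_diff_left algebra_simps)
  then have "t * (nrm d)\<^sup>2 \<le> inner (grad (v + t *\<^sub>R d)) d - inner (grad v) d"
    using t(1) by (simp add: mult_le_cancel_left)
  then have "\<phi> 0 \<le> \<phi> 1" using t(2) by simp
  then show ?thesis by (simp add: \<phi>_def d_def)
qed

text \<open>
  The first-order condition at the maximiser \<open>v\<close> is replaced by the gradient inequality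
  at the nearby points \<open>v + t (u - v)\<close>: since \<open>v\<close> is at least as good as
  such a point, the slope there towards \<open>u\<close> has the right sign. Letting
  \<open>t\<close> tend to \<open>0\<close> recovers the full quadratic gap.
\<close>

lemma strongly_convex_argmax_gap:
  fixes nrm :: "'a::euclidean_space \<Rightarrow> real" and \<omega> :: "'a \<Rightarrow> real"
  assumes nrm: "is_norm nrm"
    and deriv: "\<forall>x\<in>unit_ball nrm.
        (\<omega> has_derivative (\<lambda>d. inner (grad x) d)) (at x within unit_ball nrm)"
    and sc: "\<forall>x\<in>unit_ball nrm. \<forall>y\<in>unit_ball nrm.
        inner (grad x - grad y) (x - y) \<ge> (nrm (x - y))\<^sup>2"
    and uv: "u \<in> unit_ball nrm" "v \<in> unit_ball nrm"
    and max: "\<And>w. w \<in> unit_ball nrm \<Longrightarrow> inner z w - \<omega> w \<le> inner z v - \<omega> v"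
  shows "inner z u - \<omega> u \<le> inner z v - \<omega> v - (nrm (u - v))\<^sup>2 / 2"
proof -
  define d where "d = u - v"
  have gap: "inner z u - \<omega> u \<le> inner z v - \<omega> v - (1 - t)\<^sup>2 * (nrm d)\<^sup>2 / 2" if t: "0 < t" "t < 1" for t :: real
  proof -
    define w where "w = v + t *\<^sub>R d"
    have "w = (1 - t) *\<^sub>R v + t *\<^sub>R u" by (simp add: w_def d_def algebra_simps)
    then have w: "w \<in> unit_ball nrm" 
      using convexD_alt[OF convex_unit_ball[OF nrm] uv(2,1)] t by simp
    have vw: "v - w = - (t *\<^sub>R d)" and uw: "u - w = (1 - t) *\<^sub>R d" by (simp_all add: w_def d_def algebra_simps)
    have 1: "\<omega> w + inner (grad w) (v - w) + (nrm (v - w))\<^sup>2 / 2 \<le> \<omega> v"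
      by (rule strongly_convex_gap[OF nrm deriv sc uv(2) w])
    have 2: "\<omega> w + inner (grad w) (u - w) + (nrm (u - w))\<^sup>2 / 2 \<le> \<omega> u"
      by (rule strongly_convex_gap[OF nrm deriv sc uv(1) w])
    have zw: "inner z w = inner z v + t * inner z d" by (simp add: w_def inner_add_right)
    have "inner (grad w) (v - w) = - t * inner (grad w) d" by (simp add: vw)
    with 1 max[OF w] zw have "t * inner z d \<le> t * inner (grad w) d"
      using zero_le_power2[of "nrm (v - w)"] by linarith
    then have zd: "inner z d \<le> inner (grad w) d" using t by simp
    have zu: "inner z u = inner z w + (1 - t) * inner z d"
      using uw inner_diff_right[of z u w] by simp
    have "(1 - t) * inner z d \<le> (1 - t) * inner (grad w) d" using zd t by (intro mult_left_mono) auto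
    moreover have "inner (grad w) (u - w) = (1 - t) * inner (grad w) d" by (simp add: uw)
    moreover have "(nrm (u - w))\<^sup>2 = (1 - t)\<^sup>2 * (nrm d)\<^sup>2"
      by (simp add: uw is_normD(2)[OF nrm] power_mult_distrib)
    ultimately show ?thesis using 2 max[OF w] zu by linarith
  qed
  have lim: "((\<lambda>t::real. inner z v - \<omega> v - (1 - t)\<^sup>2 * (nrm d)\<^sup>2 / 2) \<longlongrightarrow> inner z v - \<omega> v - (1 - 0)\<^sup>2 * (nrm d)\<^sup>2 / 2) (at_right 0)"
    by (intro tendsto_intros) auto
  have "inner z u - \<omega> u \<le> inner z v - \<omega> v - (1 - 0)\<^sup>2 * (nrm d)\<^sup>2 / 2"
    by (rule tendsto_lowerbound[OF lim])
      (use gap in \<open>auto simp: eventually_at_right[of 0 1] intro: exI[of _ 1]\<close>)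
  then show ?thesis by (simp add: d_def)
qed

text \<open>
  Adding the gap inequalities of two maximisers shows that \<open>V\<close> is Lipschitz from the
  conjugate norm to the norm. Only its continuity is recorded; it makes \<open>V\<close> Borel
  measurable, as the probabilistic use requires.
\<close>

lemma prox_map:
  fixes nrm :: "'a::euclidean_space \<Rightarrow> real" and \<omega> :: "'a \<Rightarrow> real"
  assumes nrm: "is_norm nrm"
    and deriv: "\<forall>x\<in>unit_ball nrm.
        (\<omega> has_derivative (\<lambda>d. inner (grad x) d)) (at x within unit_ball nrm)"
    and sc: "\<forall>x\<in>unit_ball nrm. \<forall>y\<in>unit_ball nrm.
        inner (grad x - grad y) (x - y) \<ge> (nrm (x - y))\<^sup>2"
  obtains V where "continuous_on UNIV V" "\<And>z. V z \<in> unit_ball nrm"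
    "\<And>z u. u \<in> unit_ball nrm \<Longrightarrow> inner z u - \<omega> u \<le> inner z (V z) - \<omega> (V z) - (nrm (u - V z))\<^sup>2 / 2"
proof -
  have "continuous_on (unit_ball nrm) \<omega>"
    using deriv by (intro has_derivative_continuous_on) auto
  then have "\<exists>v\<in>unit_ball nrm. \<forall>w\<in>unit_ball nrm. inner z w - \<omega> w \<le> inner z v - \<omega> v" for z
    using zero_in_unit_ball[OF nrm] 
    by (intro continuous_attains_sup compact_unit_ball nrm continuous_intros) auto
  then obtain V where V: "\<And>z. V z \<in> unit_ball nrm"
    "\<And>z w. w \<in> unit_ball nrm \<Longrightarrow> inner z w - \<omega> w \<le> inner z (V z) - \<omega> (V z)" by metis
  have gap: "inner z u - \<omega> u \<le> inner z (V z) - \<omega> (V z) - (nrm (u - V z))\<^sup>2 / 2" if "u \<in> unit_ball nrm" for z u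
    using strongly_convex_argmax_gap[OF nrm deriv sc that V] by blast
  have lip: "nrm (V z - V z') \<le> dual_norm nrm (z - z')" for z z'
  proof -
    define n where "n = nrm (V z - V z')"
    have "n\<^sup>2 \<le> inner (z - z') (V z - V z')"
      using gap[OF V(1), of z z'] gap[OF V(1), of z' z] is_normD(7)[OF nrm, of "V z" "V z'"]
      by (simp add: n_def inner_diff_left inner_diff_right)
    also have "\<dots> \<le> n * dual_norm nrm (z - z')"
      using inner_le_dual_norm[OF nrm, of "V z - V z'" "z - z'"] by (simp add: n_def inner_commute)
    finally have "n * n \<le> n * dual_norm nrm (z - z')" by (simp add: power2_eq_square)
    moreover have "0 \<le> n" by (simp add: n_def is_normD(8)[OF nrm])
    ultimately have "n \<le> dual_norm nrm (z - z')"
      using dual_norm_nonneg[OF nrm, of "z - z'"] by (cases "n = 0") auto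
    then show ?thesis by (simp add: n_def)
  qed
  obtain k where k: "k > 0" "\<And>x. k * norm x \<le> nrm x" using is_norm_ge_norm[OF nrm] by blast
  have "(V \<longlongrightarrow> V z) (at z)" for z
  proof -
    have "isCont (\<lambda>y. dual_norm nrm (y - z)) z"
      using continuous_on_compose2[OF is_norm_continuous[OF is_norm_dual_norm[OF nrm], of UNIV], of UNIV "\<lambda>y. y - z"]
      by (simp add: continuous_on_eq_continuous_at continuous_intros)
    then have "((\<lambda>y. dual_norm nrm (y - z) / k) \<longlongrightarrow> dual_norm nrm (z - z) / k) (at z)"
      unfolding isCont_def by (intro tendsto_divide tendsto_const) (use k in auto)
    then have lim: "((\<lambda>y. dual_norm nrm (y - z) / k) \<longlongrightarrow> 0) (at z)"
      using is_normD(4)[OF is_norm_dual_norm[OF nrm]] by simp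
    have "norm (V y - V z) \<le> dual_norm nrm (y - z) / k" for y
      using k(2)[of "V y - V z"] lip[of y z] k(1) by (simp add: field_simps)
    then show ?thesis
      using Lim_null_comparison[OF always_eventually lim, of "\<lambda>y. V y - V z"] LIM_zero_cancel by blast
  qed
  then have "continuous_on UNIV V" by (simp add: continuous_on_def)
  then show ?thesis using that V(1) gap by blast
qed

text \<open>
  The supremum defining \<open>\<Omega>\<close> is over square roots, so squaring it back needs
  \<open>\<omega> \<ge> 0\<close>, which strong convexity yields from the minimum at
  \<open>0\<close>. The same lower bound \<open>(nrm u)\<^sup>2 / 2\<close> makes
  \<open>\<Omega>\<close> positive.
\<close>

lemma Omega_const_bounds:
  fixes nrm :: "'a::euclidean_space \<Rightarrow> real" and \<omega> :: "'a \<Rightarrow> real"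
  assumes nrm: "is_norm nrm"
    and deriv: "\<forall>x\<in>unit_ball nrm.
        (\<omega> has_derivative (\<lambda>d. inner (grad x) d)) (at x within unit_ball nrm)"
    and sc: "\<forall>x\<in>unit_ball nrm. \<forall>y\<in>unit_ball nrm.
        inner (grad x - grad y) (x - y) \<ge> (nrm (x - y))\<^sup>2"
    and z: "\<omega> 0 = 0" "grad 0 = 0"
  shows "u \<in> unit_ball nrm \<Longrightarrow> 0 \<le> \<omega> u" "u \<in> unit_ball nrm \<Longrightarrow> \<omega> u \<le> (Omega_const nrm \<omega>)\<^sup>2 / 2"
    "Omega_const nrm \<omega> > 0"
proof -
  have low: "(nrm u)\<^sup>2 / 2 \<le> \<omega> u" if "u \<in> unit_ball nrm" for u
    using strongly_convex_gap[OF nrm deriv sc that zero_in_unit_ball[OF nrm]] z by simp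
  then show pos: "0 \<le> \<omega> u" if "u \<in> unit_ball nrm" for u
    using order_trans[OF _ low[OF that]] by simp
  have "continuous_on (unit_ball nrm) \<omega>"
    using deriv by (intro has_derivative_continuous_on) auto
  then have "bdd_above ((\<lambda>x. sqrt (2 * \<omega> x)) ` unit_ball nrm)"
    by (intro bounded_imp_bdd_above compact_imp_bounded compact_continuous_image
      compact_unit_ball nrm continuous_intros)
  then have up: "sqrt (2 * \<omega> u) \<le> Omega_const nrm \<omega>" if "u \<in> unit_ball nrm" for u
    unfolding Omega_const_def using that by (intro cSUP_upper)
  show "\<omega> u \<le> (Omega_const nrm \<omega>)\<^sup>2 / 2" if "u \<in> unit_ball nrm"
    using power_mono[OF up[OF that], of 2] pos[OF that] by simp
  obtain b :: 'a where b: "norm b = 1" using vector_choose_size[of 1] by auto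
  then have nb: "nrm b > 0" using is_normD(1,8)[OF nrm, of b] by fastforce
  have nu: "nrm (b /\<^sub>R nrm b) = 1" using nb by (simp add: is_normD(2)[OF nrm])
  then have u: "b /\<^sub>R nrm b \<in> unit_ball nrm" by (simp add: norm_ball_0)
  have "0 < sqrt (2 * \<omega> (b /\<^sub>R nrm b))" using low[OF u] nu by simp
  then show "Omega_const nrm \<omega> > 0" using up[OF u] by linarith
qed

text \<open>
  Induction on the potential \<open>max (inner z u - \<omega> u)\<close>. Adding \<open>e\<close> to
  \<open>z\<close> raises it by at most \<open>inner e (V z)\<close> plus \<open>inner e (u - V z) -
  (nrm (u - V z))\<^sup>2 / 2\<close>, and the latter is at most half the squared conjugate norm of
  \<open>e\<close>.
\<close>

lemma dual_averaging_regret: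
  fixes nrm :: "'a::euclidean_space \<Rightarrow> real" and \<omega> :: "'a \<Rightarrow> real"
  assumes nrm: "is_norm nrm"
    and pos: "\<And>u. u \<in> unit_ball nrm \<Longrightarrow> 0 \<le> \<omega> u"
    and V: "\<And>z. V z \<in> unit_ball nrm"
      "\<And>z u. u \<in> unit_ball nrm \<Longrightarrow> inner z u - \<omega> u \<le> inner z (V z) - \<omega> (V z) - (nrm (u - V z))\<^sup>2 / 2"
    and u: "u \<in> unit_ball nrm"
  fixes n :: nat
  shows "inner (\<Sum>t=1..n. e t) u - \<omega> u \<le>
    (\<Sum>t=1..n. inner (e t) (V (\<Sum>r=1..t-1. e r))) + (\<Sum>t=1..n. (dual_norm nrm (e t))\<^sup>2) / 2"
  using u
proof (induction n arbitrary: u)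
  case 0
  then show ?case using pos by simp
next
  case (Suc n)
  define z v where "z = (\<Sum>t=1..n. e t)" and "v = V z"
  have a: "inner z u - \<omega> u \<le> inner z v - \<omega> v - (nrm (u - v))\<^sup>2 / 2"
    unfolding v_def by (rule V(2)) fact
  have b: "inner z v - \<omega> v \<le> (\<Sum>t=1..n. inner (e t) (V (\<Sum>r=1..t-1. e r)))
      + (\<Sum>t=1..n. (dual_norm nrm (e t))\<^sup>2) / 2"
    unfolding z_def using Suc.IH[of v] V(1) by (simp add: v_def)
  have "inner (e (Suc n)) (u - v) \<le> nrm (u - v) * dual_norm nrm (e (Suc n))"
    using inner_le_dual_norm[OF nrm, of "u - v" "e (Suc n)"] inner_commute[of "u - v" "e (Suc n)"] by simp
  also have "\<dots> \<le> (nrm (u - v))\<^sup>2 / 2 + (dual_norm nrm (e (Suc n)))\<^sup>2 / 2"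
    using sum_squares_bound[of "nrm (u - v)" "dual_norm nrm (e (Suc n))"] by simp
  finally have c: "inner (e (Suc n)) u - inner (e (Suc n)) v \<le> \<dots>" by (simp add: inner_diff_right)
  show ?case
    using a b c by (simp add: inner_add_left z_def v_def add_divide_distrib)
qed

section \<open>Exponential tail bounds\<close>

text \<open>
  This puts \<open>1\<close> into the set whose least element is \<open>tau_star\<close>.
\<close>

lemma exp_le_add_exp_square: "exp t \<le> t + exp (t\<^sup>2)" for t :: real
proof -
  consider "t \<ge> 1" | "0 \<le> t" "t \<le> 1" | "t \<le> 0" by linarith
  then show ?thesis
  proof cases
    case 1
    then have "t \<le> t\<^sup>2" using self_le_power[of t 2] by simp
    then have "exp t \<le> exp (t\<^sup>2)" by simp
    then show ?thesis using 1 by linarith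
  next
    case 2
    then have "exp t \<le> 1 + t + t\<^sup>2" by (rule exp_bound)
    then show ?thesis using exp_ge_add_one_self[of "t\<^sup>2"] by linarith
  next
    case 3
    have q: "1 + (-t) + (-t)\<^sup>2 / 2 \<le> exp (- t)" using 3 by (intro exp_lower_Taylor_quadratic) auto
    have e: "1 \<le> (1 + t + t\<^sup>2) * (1 + (-t) + (-t)\<^sup>2 / 2)"
    proof -
      have "(1 + t + t\<^sup>2) * (1 + (-t) + (-t)\<^sup>2 / 2) = 1 + t\<^sup>2 / 2 * ((1 - t/2)\<^sup>2 + 3 * t\<^sup>2 / 4)"
        by (simp add: field_simps power2_eq_square)
      then show ?thesis by simp
    qed
    have p: "0 \<le> 1 + t + t\<^sup>2" 
    proof -
      have "1 + t + t\<^sup>2 = ((1 + t)\<^sup>2 + 1 + t\<^sup>2) / 2" by (simp add: power2_eq_square field_simps)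
      moreover have "0 \<le> ((1 + t)\<^sup>2 + 1 + t\<^sup>2) / 2" by simp
      ultimately show ?thesis by linarith
    qed
    have "1 \<le> (1 + t + t\<^sup>2) * exp (- t)" using mult_left_mono[OF q p] e by linarith
    then have "exp t \<le> 1 + t + t\<^sup>2" by (simp add: exp_minus field_simps)
    then show ?thesis using exp_ge_add_one_self[of "t\<^sup>2"] by linarith
  qed
qed

text \<open>
  The admissible \<open>\<tau>\<close> form a closed set that contains \<open>1\<close>. Every one
  of them is positive, as \<open>t = 1\<close> shows because \<open>exp 1 > 2\<close>; hence the
  \<open>LEAST\<close> is attained.
\<close>

lemma tau_star_bound: "0 < tau_star" "exp t \<le> t + exp (tau_star * t\<^sup>2)"
proof -
  define S where "S = {\<tau>. \<forall>t::real. exp t \<le> t + exp (\<tau> * t\<^sup>2)}"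
  have pos: "0 < \<tau>" if "\<tau> \<in> S" for \<tau>
  proof (rule ccontr)
    assume "\<not> 0 < \<tau>"
    moreover have "exp 1 \<le> 1 + exp \<tau>" using that[unfolded S_def, simplified, rule_format, of 1] by simp
    ultimately have "exp (1::real) \<le> 2" by (smt (verit) exp_le_one_iff)
    moreover have "1 + 1 + 1\<^sup>2 / 2 \<le> exp (1::real)" by (rule exp_lower_Taylor_quadratic) simp
    ultimately show False by simp
  qed
  have cl: "closed S" unfolding S_def
    by (intro closed_Collect_all closed_Collect_le continuous_intros)
  have one: "1 \<in> S" using exp_le_add_exp_square by (simp add: S_def)
  define T where "T = S \<inter> {0..1}"
  have "compact T" unfolding T_def using cl by (rule closed_Int_compact) simp
  moreover have "T \<noteq> {}" using one by (auto simp: T_def)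
  ultimately obtain p where p: "p \<in> T" "\<And>q. q \<in> T \<Longrightarrow> p \<le> q"
    using continuous_attains_inf[of T "\<lambda>x. x"] continuous_on_id[of T] by blast
  have p_S: "p \<in> S" "p \<le> 1" using p(1) by (simp_all add: T_def)
  have p_bound: "exp t \<le> t + exp (p * t\<^sup>2)" for t using p_S(1) unfolding S_def by blast
  have "tau_star = p"
    unfolding tau_star_def
  proof (rule Least_equality)
    show "0 < p \<and> (\<forall>t. exp t \<le> t + exp (p * t\<^sup>2))" using p_bound pos[OF p_S(1)] by blast
  next
    fix q :: real assume q: "0 < q \<and> (\<forall>t. exp t \<le> t + exp (q * t\<^sup>2))"
    then have "q \<in> S" unfolding S_def by blast
    show "p \<le> q"
    proof (cases "q \<le> 1")
      case True
      then have "q \<in> T" using \<open>q \<in> S\<close> q by (simp add: T_def)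
      then show ?thesis by (rule p(2))
    next
      case False then show ?thesis using p_S(2) by simp
    qed
  qed
  then show "0 < tau_star" "exp t \<le> t + exp (tau_star * t\<^sup>2)"
    using p_bound pos[OF p_S(1)] by simp_all
qed

text \<open>
  The mean of \<open>exp (c X)\<close> is at most that of \<open>exp (\<tau> c\<^sup>2
  X\<^sup>2)\<close>, because the linear term of the defining inequality of \<open>\<tau> =
  tau_star\<close> has mean zero. The latter is the power \<open>\<theta> = \<tau> c\<^sup>2
  K\<^sup>2 \<le> 1\<close> of \<open>exp (X\<^sup>2 / K\<^sup>2)\<close>, and Jensen's inequality
  for that concave power gives \<open>exp \<theta>\<close>.
\<close>

lemma (in prob_space) mgf_bound:
  assumes X: "integrable M X" "expectation X = 0"
    and moment: "(\<integral>\<^sup>+w. ennreal (exp ((X w)\<^sup>2 / K\<^sup>2)) \<partial>M) \<le> ennreal (exp 1)"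
    and K: "K > 0" and c: "tau_star * c\<^sup>2 * K\<^sup>2 \<le> 1"
  shows "(\<integral>\<^sup>+w. ennreal (exp (c * X w)) \<partial>M) \<le> ennreal (exp (tau_star * c\<^sup>2 * K\<^sup>2))"
proof -
  define \<theta> where "\<theta> = tau_star * c\<^sup>2 * K\<^sup>2"
  have \<theta>: "0 \<le> \<theta>" "\<theta> \<le> 1" using tau_star_bound(1) c by (simp_all add: \<theta>_def)
  have [measurable]: "X \<in> borel_measurable M" using X(1) by (rule borel_measurable_integrable)
  define Y where "Y w = exp ((X w)\<^sup>2 / K\<^sup>2 - 1)" for w
  have [measurable]: "Y \<in> borel_measurable M" unfolding Y_def by measurable
  have Y_nn: "(\<integral>\<^sup>+w. ennreal (Y w) \<partial>M) \<le> 1"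
  proof -
    have "(\<integral>\<^sup>+w. ennreal (Y w) \<partial>M) = (\<integral>\<^sup>+w. ennreal (exp (-1)) * ennreal (exp ((X w)\<^sup>2 / K\<^sup>2)) \<partial>M)"
      by (simp add: Y_def ennreal_mult[symmetric] exp_diff exp_minus divide_inverse mult.commute)
    also have "\<dots> = ennreal (exp (-1)) * (\<integral>\<^sup>+w. ennreal (exp ((X w)\<^sup>2 / K\<^sup>2)) \<partial>M)"
      by (rule nn_integral_cmult) measurable
    also have "\<dots> \<le> ennreal (exp (-1)) * ennreal (exp 1)" by (intro mult_left_mono moment) simp
    also have "\<dots> = 1" by (simp add: ennreal_mult[symmetric] exp_minus)
    finally show ?thesis .
  qed
  have Y_int: "integrable M Y"
    using Y_nn by (intro integrableI_bounded) (auto simp: Y_def elim: le_less_trans)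
  have Y_le: "expectation Y \<le> 1"
    using Y_nn by (subst (asm) nn_integral_eq_integral[OF Y_int]) (auto simp: Y_def)
  have pt: "exp (c * X w) \<le> c * X w + exp \<theta> * (1 - \<theta> + \<theta> * Y w)" for w
  proof -
    \<comment> \<open>Jensen's inequality in pointwise form: convexity of \<open>exp\<close> between \<open>0\<close> and \<open>(X w)\<^sup>2 / K\<^sup>2 - 1\<close>. The shift by \<open>1\<close> makes \<open>Y\<close> a variable of mean at most \<open>1\<close>.\<close>
    have "exp ((1 - \<theta>) *\<^sub>R 0 + \<theta> *\<^sub>R ((X w)\<^sup>2 / K\<^sup>2 - 1)) \<le> (1 - \<theta>) * exp 0 + \<theta> * exp ((X w)\<^sup>2 / K\<^sup>2 - 1)"
      using \<theta> by (intro convex_onD[OF exp_convex]) auto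
    then have "exp \<theta> * exp (\<theta> * ((X w)\<^sup>2 / K\<^sup>2 - 1)) \<le> exp \<theta> * (1 - \<theta> + \<theta> * Y w)"
      by (intro mult_left_mono) (simp_all add: Y_def)
    moreover have "exp \<theta> * exp (\<theta> * ((X w)\<^sup>2 / K\<^sup>2 - 1)) = exp (tau_star * (c * X w)\<^sup>2)"
      using K by (simp add: \<theta>_def field_simps flip: exp_add)
    ultimately show ?thesis using tau_star_bound(2)[of "c * X w"] by linarith
  qed
  have int: "integrable M (\<lambda>w. c * X w + exp \<theta> * (1 - \<theta> + \<theta> * Y w))"
    using X(1) Y_int by simp
  have "expectation (\<lambda>w. c * X w + exp \<theta> * (1 - \<theta> + \<theta> * Y w)) = exp \<theta> * (1 - \<theta> + \<theta> * expectation Y)"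
    using X Y_int by (simp add: prob_space)
  also have "\<dots> \<le> exp \<theta> * (1 - \<theta> + \<theta> * 1)"
    using \<theta> Y_le by (intro mult_left_mono add_left_mono) auto
  finally have le: "expectation (\<lambda>w. c * X w + exp \<theta> * (1 - \<theta> + \<theta> * Y w)) \<le> exp \<theta>" by simp
  have "(\<integral>\<^sup>+w. ennreal (exp (c * X w)) \<partial>M) \<le> (\<integral>\<^sup>+w. ennreal (c * X w + exp \<theta> * (1 - \<theta> + \<theta> * Y w)) \<partial>M)"
    by (intro nn_integral_mono ennreal_leI pt)
  also have "\<dots> = ennreal (expectation (\<lambda>w. c * X w + exp \<theta> * (1 - \<theta> + \<theta> * Y w)))"
    using pt order_trans[OF exp_ge_zero] by (intro nn_integral_eq_integral int) auto
  also have "\<dots> \<le> ennreal (exp \<theta>)" by (intro ennreal_leI le)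
  finally show ?thesis by (simp add: \<theta>_def)
qed

text \<open>
  The summand at time \<open>t\<close> sees the past only through the partial sum of
  \<open>\<eta>\<close>, and \<open>\<xi> t\<close> is independent of that past. Integrating out the
  last sample first, by Fubini, therefore costs one factor \<open>B\<close>, whatever the past was.
\<close>

lemma (in prob_space) exp_adapted_sum_bound:
  fixes \<xi> :: "nat \<Rightarrow> 'a \<Rightarrow> 'b" and \<eta> :: "'b \<Rightarrow> 'e::euclidean_space"
  assumes indep: "indep_vars (\<lambda>_. S) \<xi> {1..}"
    and distr: "\<And>t. 1 \<le> t \<Longrightarrow> distr M S (\<xi> t) = P"
    and \<eta>[measurable]: "\<eta> \<in> borel_measurable S"
    and \<psi>[measurable]: "(\<lambda>(z, b). \<psi> z b) \<in> borel_measurable (borel \<Otimes>\<^sub>M S)"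
    and step: "\<And>z. (\<integral>\<^sup>+b. ennreal (exp (\<psi> z b)) \<partial>P) \<le> ennreal B" and B: "B \<ge> 0"
  shows "(\<integral>\<^sup>+w. ennreal (exp (\<Sum>t=1..n. \<psi> (\<Sum>r=1..t-1. \<eta> (\<xi> r w)) (\<xi> t w))) \<partial>M) \<le> ennreal (B ^ n)"
proof (induction n)
  case 0
  then show ?case by (simp add: emeasure_space_1)
next
  case (Suc n)
  have \<xi>[measurable]: "\<xi> t \<in> measurable M S" if "1 \<le> t" for t
    using indep that by (auto simp: indep_vars_def)
  define A :: "(nat \<Rightarrow> 'b) \<Rightarrow> real" where "A x = (\<Sum>t=1..n. \<psi> (\<Sum>r=1..t-1. \<eta> (x r)) (x t))" for x
  define Z :: "(nat \<Rightarrow> 'b) \<Rightarrow> 'e" where "Z x = (\<Sum>r=1..n. \<eta> (x r))" for x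
  have \<eta>m: "(\<lambda>x. \<eta> (x r)) \<in> borel_measurable (PiM {1..n} (\<lambda>_. S))" if "r \<in> {1..n}" for r
    using measurable_compose[OF measurable_component_singleton[OF that] \<eta>] .
  have \<psi>m: "(\<lambda>x. \<psi> (\<Sum>r=1..t-1. \<eta> (x r)) (x t)) \<in> borel_measurable (PiM {1..n} (\<lambda>_. S))"
    if t: "t \<in> {1..n}" for t
  proof -
    have "(\<lambda>x. (\<Sum>r=1..t-1. \<eta> (x r), x t)) \<in> measurable (PiM {1..n} (\<lambda>_. S)) (borel \<Otimes>\<^sub>M S)"
      using t by (intro measurable_Pair borel_measurable_sum \<eta>m measurable_component_singleton) auto
    from measurable_compose[OF this \<psi>] show ?thesis by simp
  qed
  \<comment> \<open>\<open>indep_var\<close> relates two variables of the same type, so past and present are both represented as families of samples, the present one with the single index \<open>Suc n\<close>.\<close>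
  define U W where "U w = restrict (\<lambda>r. \<xi> r w) {1..n}" and "W w = restrict (\<lambda>r. \<xi> r w) {Suc n}" for w
  let ?SU = "PiM {1..n} (\<lambda>_. S)" and ?SW = "PiM {Suc n} (\<lambda>_. S)"
  have ind: "indep_var ?SU U ?SW W"
    unfolding U_def W_def by (rule indep_var_restrict[OF indep]) auto
  have U[measurable]: "U \<in> measurable M ?SU" using ind by (rule indep_var_rv1)
  have W[measurable]: "W \<in> measurable M ?SW" using ind by (rule indep_var_rv2)
  have joint: "distr M ?SU U \<Otimes>\<^sub>M distr M ?SW W = distr M (?SU \<Otimes>\<^sub>M ?SW) (\<lambda>w. (U w, W w))"
    using ind by (simp add: indep_var_distribution_eq)
  interpret W: prob_space "distr M ?SW W" by (rule prob_space_distr) measurable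
  have A_U: "A (U w) = A (\<lambda>r. \<xi> r w)" and Z_U: "Z (U w) = Z (\<lambda>r. \<xi> r w)" for w
    by (auto simp: U_def A_def Z_def intro!: sum.cong arg_cong2[where f=\<psi>])
  have [measurable]: "A \<in> borel_measurable ?SU" "Z \<in> borel_measurable ?SU"
    unfolding A_def Z_def by (intro borel_measurable_sum \<eta>m \<psi>m, assumption)+
  have [measurable]: "(\<lambda>y. y (Suc n)) \<in> measurable ?SW S"
    by (rule measurable_component_singleton) simp
  define g :: "(nat \<Rightarrow> 'b) \<times> (nat \<Rightarrow> 'b) \<Rightarrow> ennreal"
    where "g p = ennreal (exp (A (fst p) + \<psi> (Z (fst p)) (snd p (Suc n))))" for p
  have "(\<lambda>p. (Z (fst p), snd p (Suc n))) \<in> measurable (?SU \<Otimes>\<^sub>M ?SW) (borel \<Otimes>\<^sub>M S)" by measurable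
  from measurable_compose[OF this \<psi>]
  have [measurable]: "(\<lambda>p. \<psi> (Z (fst p)) (snd p (Suc n))) \<in> borel_measurable (?SU \<Otimes>\<^sub>M ?SW)" by simp
  have g[measurable]: "g \<in> borel_measurable (?SU \<Otimes>\<^sub>M ?SW)" unfolding g_def by measurable
  have sP2: "sets (distr M ?SU U \<Otimes>\<^sub>M distr M ?SW W) = sets (?SU \<Otimes>\<^sub>M ?SW)"
    by (intro sets_pair_measure_cong) simp_all
  have gm: "g \<in> borel_measurable (distr M ?SU U \<Otimes>\<^sub>M distr M ?SW W)"
    using g measurable_cong_sets[OF sP2 refl] by blast
  have \<psi>z[measurable]: "\<psi> z \<in> borel_measurable S" for z
    using measurable_compose[OF measurable_Pair1'[of z borel S] \<psi>] by simp
  have inner: "(\<integral>\<^sup>+y. ennreal (exp (\<psi> z (y (Suc n)))) \<partial>distr M ?SW W) \<le> ennreal B" for z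
  proof -
    have "(\<integral>\<^sup>+y. ennreal (exp (\<psi> z (y (Suc n)))) \<partial>distr M ?SW W) = (\<integral>\<^sup>+w. ennreal (exp (\<psi> z (\<xi> (Suc n) w))) \<partial>M)"
      by (subst nn_integral_distr) (auto simp: W_def)
    also have "\<dots> = (\<integral>\<^sup>+b. ennreal (exp (\<psi> z b)) \<partial>distr M S (\<xi> (Suc n)))"
      by (rule nn_integral_distr[symmetric]) (auto intro: \<xi>)
    also have "\<dots> \<le> ennreal B" using step[of z] distr[of "Suc n"] by simp
    finally show ?thesis .
  qed
  have "(\<integral>\<^sup>+w. ennreal (exp (\<Sum>t=1..Suc n. \<psi> (\<Sum>r=1..t-1. \<eta> (\<xi> r w)) (\<xi> t w))) \<partial>M)
      = (\<integral>\<^sup>+w. g (U w, W w) \<partial>M)"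
    unfolding g_def fst_conv snd_conv A_U Z_U by (simp add: A_def Z_def W_def)
  also have "\<dots> = (\<integral>\<^sup>+p. g p \<partial>distr M (?SU \<Otimes>\<^sub>M ?SW) (\<lambda>w. (U w, W w)))"
    by (rule nn_integral_distr[symmetric]) measurable
  also have "\<dots> = (\<integral>\<^sup>+x. \<integral>\<^sup>+y. g (x, y) \<partial>distr M ?SW W \<partial>distr M ?SU U)"
    unfolding joint[symmetric] by (rule W.nn_integral_fst[OF gm, symmetric])
  also have "\<dots> \<le> (\<integral>\<^sup>+x. ennreal (exp (A x)) * ennreal B \<partial>distr M ?SU U)"
  proof (rule nn_integral_mono)
    fix x
    have "(\<integral>\<^sup>+y. g (x, y) \<partial>distr M ?SW W)
        = (\<integral>\<^sup>+y. ennreal (exp (A x)) * ennreal (exp (\<psi> (Z x) (y (Suc n)))) \<partial>distr M ?SW W)"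
      by (simp add: g_def exp_add ennreal_mult)
    also have "\<dots> = ennreal (exp (A x)) * (\<integral>\<^sup>+y. ennreal (exp (\<psi> (Z x) (y (Suc n)))) \<partial>distr M ?SW W)"
      by (intro nn_integral_cmult) measurable
    also have "\<dots> \<le> ennreal (exp (A x)) * ennreal B" by (intro mult_left_mono inner) simp
    finally show "(\<integral>\<^sup>+y. g (x, y) \<partial>distr M ?SW W) \<le> ennreal (exp (A x)) * ennreal B" .
  qed
  also have "\<dots> = (\<integral>\<^sup>+x. ennreal (exp (A x)) \<partial>distr M ?SU U) * ennreal B"
    by (rule nn_integral_multc) measurable
  also have "(\<integral>\<^sup>+x. ennreal (exp (A x)) \<partial>distr M ?SU U) = (\<integral>\<^sup>+w. ennreal (exp (A (U w))) \<partial>M)"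
    by (rule nn_integral_distr) measurable
  also have "\<dots> * ennreal B \<le> ennreal (B ^ n) * ennreal B"
    unfolding A_U by (intro mult_right_mono) (use Suc.IH in \<open>simp_all add: A_def\<close>)
  also have "\<dots> = ennreal (B ^ Suc n)" using B by (simp add: ennreal_mult[symmetric] mult.commute)
  finally show ?case .
qed

lemma adapted_sum_measurable:
  fixes \<xi> :: "nat \<Rightarrow> 'a \<Rightarrow> 'b" and \<eta> :: "'b \<Rightarrow> 'e::euclidean_space"
  assumes \<xi>: "\<And>t. 1 \<le> t \<Longrightarrow> \<xi> t \<in> measurable M S"
    and \<eta>: "\<eta> \<in> borel_measurable S"
    and \<psi>: "(\<lambda>(z, b). \<psi> z b) \<in> borel_measurable (borel \<Otimes>\<^sub>M S)"
  shows "(\<lambda>w. \<Sum>t=1..n. \<psi> (\<Sum>r=1..t-1. \<eta> (\<xi> r w)) (\<xi> t w) :: real) \<in> borel_measurable M"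
proof (intro borel_measurable_sum)
  fix t assume t: "t \<in> {1..n}"
  have "(\<lambda>w. (\<Sum>r=1..t-1. \<eta> (\<xi> r w), \<xi> t w)) \<in> measurable M (borel \<Otimes>\<^sub>M S)"
    using t by (intro measurable_Pair borel_measurable_sum measurable_compose[OF \<xi> \<eta>] \<xi>) auto
  from measurable_compose[OF this \<psi>]
  show "(\<lambda>w. \<psi> (\<Sum>r=1..t-1. \<eta> (\<xi> r w)) (\<xi> t w)) \<in> borel_measurable M" by simp
qed

lemma (in prob_space) adapted_sum_tail:
  fixes \<xi> :: "nat \<Rightarrow> 'a \<Rightarrow> 'b" and \<eta> :: "'b \<Rightarrow> 'e::euclidean_space"
  assumes indep: "indep_vars (\<lambda>_. S) \<xi> {1..}"
    and distr: "\<And>t. 1 \<le> t \<Longrightarrow> distr M S (\<xi> t) = P"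
    and \<eta>: "\<eta> \<in> borel_measurable S"
    and \<psi>: "(\<lambda>(z, b). \<psi> z b) \<in> borel_measurable (borel \<Otimes>\<^sub>M S)"
    and c: "c > 0"
    and step: "\<And>z. (\<integral>\<^sup>+b. ennreal (exp (c * \<psi> z b)) \<partial>P) \<le> ennreal B" and B: "B \<ge> 0"
  shows "\<P>(w in M. K < (\<Sum>t=1..n. \<psi> (\<Sum>r=1..t-1. \<eta> (\<xi> r w)) (\<xi> t w))) \<le> B ^ n * exp (- (c * K))"
proof -
  define T where "T w = (\<Sum>t=1..n. \<psi> (\<Sum>r=1..t-1. \<eta> (\<xi> r w)) (\<xi> t w))" for w
  have \<xi>: "\<xi> t \<in> measurable M S" if "1 \<le> t" for t
    using indep that by (auto simp: indep_vars_def)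
  have T[measurable]: "T \<in> borel_measurable M"
    unfolding T_def by (rule adapted_sum_measurable[OF \<xi> \<eta> \<psi>])
  have "(\<lambda>(z, b). c * \<psi> z b) \<in> borel_measurable (borel \<Otimes>\<^sub>M S)"
    using borel_measurable_times[OF borel_measurable_const[of c] \<psi>] by (simp add: case_prod_unfold)
  from exp_adapted_sum_bound[OF indep distr \<eta> this step B, of n]
  have le: "(\<integral>\<^sup>+w. ennreal (exp (c * T w)) \<partial>M) \<le> ennreal (B ^ n)"
    by (simp add: T_def sum_distrib_left)
  have "ennreal \<P>(w in M. K < T w) = emeasure M {w \<in> space M. K < T w}"
    by (simp add: emeasure_eq_measure)
  also have "\<dots> \<le> emeasure M {w \<in> space M. 1 \<le> ennreal (exp (- (c * K))) * ennreal (exp (c * T w))}"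
  proof (intro emeasure_mono)
    show "{w \<in> space M. K < T w} \<subseteq> {w \<in> space M. 1 \<le> ennreal (exp (- (c * K))) * ennreal (exp (c * T w))}"
      using c by (auto simp: ennreal_mult[symmetric] mult_left_mono less_imp_le simp flip: exp_add)
  qed measurable
  also have "\<dots> \<le> ennreal (exp (- (c * K))) * (\<integral>\<^sup>+w. ennreal (exp (c * T w)) * indicator (space M) w \<partial>M)"
    by (rule nn_integral_Markov_inequality) measurable
  also have "(\<integral>\<^sup>+w. ennreal (exp (c * T w)) * indicator (space M) w \<partial>M) = (\<integral>\<^sup>+w. ennreal (exp (c * T w)) \<partial>M)"
    by (intro nn_integral_cong) simp
  also have "ennreal (exp (- (c * K))) * \<dots> \<le> ennreal (exp (- (c * K))) * ennreal (B ^ n)"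
    by (intro mult_left_mono le) simp
  also have "\<dots> = ennreal (B ^ n * exp (- (c * K)))" using B by (simp add: ennreal_mult[symmetric] mult.commute)
  finally show ?thesis using B by (simp add: T_def)
qed

text \<open>
  The hypotheses make every conditional mean zero, so \<open>mgf_bound\<close> applies conditionally
  on the past. Optimising the Chernoff exponent gives the Gaussian tail, and the restriction on
  \<open>lam\<close> is exactly the range in which the optimal parameter is admissible for
  \<open>mgf_bound\<close>.
\<close>

lemma (in prob_space) martingale_tail:
  fixes \<xi> :: "nat \<Rightarrow> 'a \<Rightarrow> 'b" and \<eta> :: "'b \<Rightarrow> 'e::euclidean_space"
  assumes P: "prob_space P"
    and indep: "indep_vars (\<lambda>_. S) \<xi> {1..}"
    and distr: "\<And>t. 1 \<le> t \<Longrightarrow> distr M S (\<xi> t) = P"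
    and \<eta>: "\<eta> \<in> borel_measurable S"
    and \<psi>: "(\<lambda>(z, b). \<psi> z b) \<in> borel_measurable (borel \<Otimes>\<^sub>M S)"
    and mean: "\<And>z. integrable P (\<psi> z)" "\<And>z. integral\<^sup>L P (\<psi> z) = 0"
    and moment: "\<And>z. (\<integral>\<^sup>+b. ennreal (exp ((\<psi> z b)\<^sup>2 / K\<^sup>2)) \<partial>P) \<le> ennreal (exp 1)"
    and K: "K > 0" and n: "n > 0" and lam: "lam \<in> {0..2 * sqrt (tau_star * real n)}"
  shows "\<P>(w in M. lam * K * sqrt (real n) < (\<Sum>t=1..n. \<psi> (\<Sum>r=1..t-1. \<eta> (\<xi> r w)) (\<xi> t w)))
    \<le> exp (- (lam\<^sup>2 / (4 * tau_star)))"
proof (cases "lam = 0")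
  case True
  then show ?thesis by simp
next
  case False
  with lam have lam0: "lam > 0" by simp
  note tau = tau_star_bound(1)
  \<comment> \<open>The minimiser of the Chernoff exponent \<open>tau_star * c\<^sup>2 * K\<^sup>2 * n - c * lam * K * sqrt n\<close>.\<close>
  define c where "c = lam / (2 * tau_star * K * sqrt (real n))"
  have c: "c > 0" using lam0 tau K n by (simp add: c_def)
  have c2: "tau_star * c\<^sup>2 * K\<^sup>2 = lam\<^sup>2 / (4 * tau_star * real n)"
    using tau K n by (simp add: c_def power_mult_distrib power_divide power2_eq_square)
  have "lam\<^sup>2 \<le> (2 * sqrt (tau_star * real n))\<^sup>2" using lam by (intro power_mono) auto
  then have "tau_star * c\<^sup>2 * K\<^sup>2 \<le> 1"
    unfolding c2 using tau n by (simp add: power_mult_distrib)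
  then have "(\<integral>\<^sup>+b. ennreal (exp (c * \<psi> z b)) \<partial>P) \<le> ennreal (exp (tau_star * c\<^sup>2 * K\<^sup>2))" for z
    by (intro prob_space.mgf_bound[OF P mean moment K])
  from adapted_sum_tail[OF indep distr \<eta> \<psi> c this, of "lam * K * sqrt (real n)" n]
  have "\<P>(w in M. lam * K * sqrt (real n) < (\<Sum>t=1..n. \<psi> (\<Sum>r=1..t-1. \<eta> (\<xi> r w)) (\<xi> t w)))
    \<le> exp (tau_star * c\<^sup>2 * K\<^sup>2) ^ n * exp (- (c * (lam * K * sqrt (real n))))" by simp
  also have "exp (tau_star * c\<^sup>2 * K\<^sup>2) ^ n = exp (lam\<^sup>2 / (4 * tau_star))"
    unfolding c2 using n by (simp flip: exp_of_nat_mult)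
  also have "c * (lam * K * sqrt (real n)) = lam\<^sup>2 / (2 * tau_star)"
    using K n tau by (simp add: c_def power2_eq_square)
  also have "exp (lam\<^sup>2 / (4 * tau_star)) * exp (- (lam\<^sup>2 / (2 * tau_star))) = exp (- (lam\<^sup>2 / (4 * tau_star)))"
    by (simp flip: exp_add add: field_simps)
  finally show ?thesis .
qed

text \<open>
  The case of summands that ignore the past.
\<close>

lemma (in prob_space) iid_sum_tail:
  fixes \<xi> :: "nat \<Rightarrow> 'a \<Rightarrow> 'b" and \<zeta> :: "'b \<Rightarrow> real"
  assumes P: "prob_space P"
    and indep: "indep_vars (\<lambda>_. S) \<xi> {1..}"
    and distr: "\<And>t. 1 \<le> t \<Longrightarrow> distr M S (\<xi> t) = P"
    and mean: "integrable P \<zeta>" "integral\<^sup>L P \<zeta> = 0"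
    and moment: "(\<integral>\<^sup>+b. ennreal (exp ((\<zeta> b)\<^sup>2 / K\<^sup>2)) \<partial>P) \<le> ennreal (exp 1)"
    and K: "K > 0" and n: "n > 0" and lam: "lam \<in> {0..2 * sqrt (tau_star * real n)}"
  shows "\<P>(w in M. lam * K * sqrt (real n) < (\<Sum>t=1..n. \<zeta> (\<xi> t w))) \<le> exp (- (lam\<^sup>2 / (4 * tau_star)))"
proof -
  have "sets P = sets S" using distr[of 1] by auto
  then have [measurable]: "\<zeta> \<in> borel_measurable S"
    using borel_measurable_integrable[OF mean(1)] measurable_cong_sets by blast
  show ?thesis
    using martingale_tail[where \<psi> = "\<lambda>(_::real). \<zeta>" and \<eta> = "\<lambda>_. 0", OF P indep distr _ _ mean moment K n lam] by simp
qed

text \<open>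
  Dual averaging bounds the conjugate norm by a martingale and a sum of squares. The two terms of
  the bound are the probabilities that one of them is large.
\<close>

lemma (in prob_space) dual_norm_sum_tail:
  fixes nrm :: "'e::euclidean_space \<Rightarrow> real" and \<omega> :: "'e \<Rightarrow> real"
    and \<xi> :: "nat \<Rightarrow> 'a \<Rightarrow> 'b" and \<eta> :: "'b \<Rightarrow> 'e"
  assumes nrm: "is_norm nrm"
    and deriv: "\<forall>x\<in>unit_ball nrm.
        (\<omega> has_derivative (\<lambda>d. inner (grad x) d)) (at x within unit_ball nrm)"
    and sc: "\<forall>x\<in>unit_ball nrm. \<forall>y\<in>unit_ball nrm.
        inner (grad x - grad y) (x - y) \<ge> (nrm (x - y))\<^sup>2"
    and zero: "\<omega> 0 = 0" "grad 0 = 0"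
    and P: "prob_space P"
    and indep: "indep_vars (\<lambda>_. S) \<xi> {1..}"
    and distr: "\<And>t. 1 \<le> t \<Longrightarrow> distr M S (\<xi> t) = P"
    and \<eta>[measurable]: "\<eta> \<in> borel_measurable S"
    and mean: "\<And>u. integrable P (\<lambda>b. inner (\<eta> b) u)" "\<And>u. (\<integral>b. inner (\<eta> b) u \<partial>P) = 0"
    and moment: "(\<integral>\<^sup>+b. ennreal (exp ((dual_norm nrm (\<eta> b))\<^sup>2 / K\<^sup>2)) \<partial>P) \<le> ennreal (exp 1)"
    and K: "K > 0" and n: "n > 0" and lam: "lam \<in> {0..2 * sqrt (tau_star * real n)}"
  shows "\<P>(w in M. K * sqrt (real n) * (Omega_const nrm \<omega> / 2 * (1 + s\<^sup>2) + lam)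
        < dual_norm nrm (\<Sum>t=1..n. \<eta> (\<xi> t w)))
    \<le> exp (- real n * (s\<^sup>2 - 1)) + exp (- (lam\<^sup>2 / (4 * tau_star)))"
proof -
  define \<Omega> where "\<Omega> = Omega_const nrm \<omega>"
  \<comment> \<open>This step size balances \<open>\<Omega>\<^sup>2 / 2\<close> against the quadratic term, whose typical size is \<open>\<gamma>\<^sup>2 * K\<^sup>2 * n / 2\<close>.\<close>
  define \<gamma> where "\<gamma> = \<Omega> / (K * sqrt (real n))"
  have pos: "0 \<le> \<omega> u" and up: "\<omega> u \<le> \<Omega>\<^sup>2 / 2" if "u \<in> unit_ball nrm" for u
    using Omega_const_bounds[OF nrm deriv sc zero] that by (simp_all add: \<Omega>_def)
  have \<Omega>: "\<Omega> > 0" using Omega_const_bounds(3)[OF nrm deriv sc zero] by (simp add: \<Omega>_def)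
  have \<gamma>: "\<gamma> > 0" using \<Omega> K n by (simp add: \<gamma>_def)
  obtain V where V: "continuous_on UNIV V" "\<And>z. V z \<in> unit_ball nrm"
    "\<And>z u. u \<in> unit_ball nrm \<Longrightarrow> inner z u - \<omega> u \<le> inner z (V z) - \<omega> (V z) - (nrm (u - V z))\<^sup>2 / 2"
    using prox_map[OF nrm deriv sc] by blast
  have [measurable]: "V \<in> borel_measurable borel" using V(1) by (rule borel_measurable_continuous_onI)
  have dual_m[measurable]: "dual_norm nrm \<in> borel_measurable borel"
    by (intro borel_measurable_continuous_onI is_norm_continuous is_norm_dual_norm nrm)
  have \<xi>[measurable]: "\<xi> t \<in> measurable M S" if "1 \<le> t" for t
    using indep that by (auto simp: indep_vars_def)
  \<comment> \<open>\<open>\<psi>\<close> gives the martingale differences of the regret bound and \<open>\<rho>\<close> its squared norms.\<close>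
  define \<psi> where "\<psi> = (\<lambda>z b. inner (\<eta> b) (V (\<gamma> *\<^sub>R z)))"
  define \<rho> where "\<rho> = (\<lambda>(z::'e) b. (dual_norm nrm (\<eta> b))\<^sup>2 / K\<^sup>2)"
  have \<psi>: "(\<lambda>(z, b). \<psi> z b) \<in> borel_measurable (borel \<Otimes>\<^sub>M S)" unfolding \<psi>_def by measurable
  have \<rho>: "(\<lambda>(z, b). \<rho> z b) \<in> borel_measurable (borel \<Otimes>\<^sub>M S)" unfolding \<rho>_def by measurable
  define E1 where "E1 = {w \<in> space M. lam * K * sqrt (real n) < (\<Sum>t=1..n. \<psi> (\<Sum>r=1..t-1. \<eta> (\<xi> r w)) (\<xi> t w))}"
  define E2 where "E2 = {w \<in> space M. real n * s\<^sup>2 < (\<Sum>t=1..n. \<rho> (\<Sum>r=1..t-1. \<eta> (\<xi> r w)) (\<xi> t w))}"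
  have [measurable]: "E1 \<in> sets M" "E2 \<in> sets M"
    unfolding E1_def E2_def
    using adapted_sum_measurable[OF \<xi> \<eta> \<psi>] adapted_sum_measurable[OF \<xi> \<eta> \<rho>] by measurable
  have "prob E1 \<le> exp (- (lam\<^sup>2 / (4 * tau_star)))"
    unfolding E1_def
  proof (rule martingale_tail[OF P indep distr \<eta> \<psi> _ _ _ K n lam])
    show "integrable P (\<psi> z)" "integral\<^sup>L P (\<psi> z) = 0" for z
      using mean by (simp_all add: \<psi>_def)
    show "(\<integral>\<^sup>+b. ennreal (exp ((\<psi> z b)\<^sup>2 / K\<^sup>2)) \<partial>P) \<le> ennreal (exp 1)" for z
    proof (rule order_trans[OF nn_integral_mono moment])
      fix b
      define v where "v = V (\<gamma> *\<^sub>R z)"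
      have v: "nrm v \<le> 1" using V(2) by (simp add: v_def norm_ball_0)
      have le: "inner (\<eta> b) u \<le> dual_norm nrm (\<eta> b)" if "nrm u \<le> 1" for u
        using inner_le_dual_norm[OF nrm, of u "\<eta> b"] that
          mult_right_mono[OF that dual_norm_nonneg[OF nrm, of "\<eta> b"]] by (simp add: inner_commute)
      have "\<bar>\<psi> z b\<bar> \<le> dual_norm nrm (\<eta> b)"
        using le[OF v] le[of "- v"] v by (simp add: \<psi>_def v_def is_normD(5)[OF nrm])
      then have "(\<psi> z b)\<^sup>2 \<le> (dual_norm nrm (\<eta> b))\<^sup>2"
        by (rule abs_le_square_iff[THEN iffD1, OF order_trans[OF _ abs_ge_self]])
      then show "ennreal (exp ((\<psi> z b)\<^sup>2 / K\<^sup>2)) \<le> ennreal (exp ((dual_norm nrm (\<eta> b))\<^sup>2 / K\<^sup>2))"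
        by (intro ennreal_leI) (simp add: divide_right_mono)
    qed
  qed
  moreover have "prob E2 \<le> exp 1 ^ n * exp (- (1 * (real n * s\<^sup>2)))"
    unfolding E2_def
    by (rule adapted_sum_tail[OF indep distr \<eta> \<rho>]) (use moment in \<open>simp_all add: \<rho>_def\<close>)
  moreover have "exp 1 ^ n * exp (- (1 * (real n * s\<^sup>2))) = exp (- real n * (s\<^sup>2 - 1))"
    by (simp add: algebra_simps flip: exp_of_nat_mult exp_add)
  moreover have "\<P>(w in M. K * sqrt (real n) * (\<Omega> / 2 * (1 + s\<^sup>2) + lam)
        < dual_norm nrm (\<Sum>t=1..n. \<eta> (\<xi> t w))) \<le> prob (E1 \<union> E2)"
  proof (rule finite_measure_mono)
    show "{w \<in> space M. K * sqrt (real n) * (\<Omega> / 2 * (1 + s\<^sup>2) + lam)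
        < dual_norm nrm (\<Sum>t=1..n. \<eta> (\<xi> t w))} \<subseteq> E1 \<union> E2"
    proof (intro subsetI, rule ccontr)
      fix w assume "w \<in> {w \<in> space M. K * sqrt (real n) * (\<Omega> / 2 * (1 + s\<^sup>2) + lam)
        < dual_norm nrm (\<Sum>t=1..n. \<eta> (\<xi> t w))}" and "w \<notin> E1 \<union> E2"
      then have w: "w \<in> space M" "w \<notin> E1" "w \<notin> E2"
        and big: "K * sqrt (real n) * (\<Omega> / 2 * (1 + s\<^sup>2) + lam) < dual_norm nrm (\<Sum>t=1..n. \<eta> (\<xi> t w))"
        by auto
      define e where "e t = \<gamma> *\<^sub>R \<eta> (\<xi> t w)" for t
      have s1: "(\<Sum>t=1..n. inner (e t) (V (\<Sum>r=1..t-1. e r))) \<le> \<gamma> * (lam * K * sqrt (real n))"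
      proof -
        have "(\<Sum>t=1..n. inner (e t) (V (\<Sum>r=1..t-1. e r))) = \<gamma> * (\<Sum>t=1..n. \<psi> (\<Sum>r=1..t-1. \<eta> (\<xi> r w)) (\<xi> t w))"
          by (simp add: e_def \<psi>_def sum_distrib_left scaleR_sum_right)
        also have "\<dots> \<le> \<gamma> * (lam * K * sqrt (real n))"
          using w \<gamma> by (intro mult_left_mono) (auto simp: E1_def not_less)
        finally show ?thesis .
      qed
      have s2: "(\<Sum>t=1..n. (dual_norm nrm (e t))\<^sup>2) \<le> \<gamma>\<^sup>2 * (K\<^sup>2 * (real n * s\<^sup>2))"
      proof -
        have "(\<Sum>t=1..n. (dual_norm nrm (e t))\<^sup>2) = \<gamma>\<^sup>2 * (K\<^sup>2 * (\<Sum>t=1..n. \<rho> (\<Sum>r=1..t-1. \<eta> (\<xi> r w)) (\<xi> t w)))"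
          using K by (simp add: e_def \<rho>_def is_normD(2)[OF is_norm_dual_norm[OF nrm]] power_mult_distrib sum_distrib_left)
        also have "\<dots> \<le> \<gamma>\<^sup>2 * (K\<^sup>2 * (real n * s\<^sup>2))"
          using w by (intro mult_left_mono) (auto simp: E2_def not_less)
        finally show ?thesis .
      qed
      have "dual_norm nrm (\<Sum>t=1..n. \<eta> (\<xi> t w)) \<le> K * sqrt (real n) * (\<Omega> / 2 * (1 + s\<^sup>2) + lam)"
      proof (rule dual_norm_least[OF nrm])
        fix u assume "nrm u \<le> 1"
        then have u: "u \<in> unit_ball nrm" by (simp add: norm_ball_0)
        have "\<gamma> * inner u (\<Sum>t=1..n. \<eta> (\<xi> t w)) = inner (\<Sum>t=1..n. e t) u"
          by (simp add: e_def inner_commute flip: scaleR_sum_right)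
        also have "\<dots> \<le> \<omega> u + (\<Sum>t=1..n. inner (e t) (V (\<Sum>r=1..t-1. e r))) + (\<Sum>t=1..n. (dual_norm nrm (e t))\<^sup>2) / 2"
          using dual_averaging_regret[where e = e and n = n, OF nrm pos V(2,3) u] by linarith
        also have "\<dots> \<le> \<Omega>\<^sup>2 / 2 + \<gamma> * (lam * K * sqrt (real n)) + \<gamma>\<^sup>2 * (K\<^sup>2 * (real n * s\<^sup>2)) / 2"
          using up[OF u] s1 s2 by linarith
        also have "\<gamma>\<^sup>2 * (K\<^sup>2 * (real n * s\<^sup>2)) = \<Omega>\<^sup>2 * s\<^sup>2"
          using K n by (simp add: \<gamma>_def power_divide power_mult_distrib)
        also have "\<Omega>\<^sup>2 = \<gamma> * (K * sqrt (real n)) * \<Omega>"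
          using K n by (simp add: \<gamma>_def power2_eq_square)
        also have "\<gamma> * (K * sqrt (real n)) * \<Omega> / 2 + \<gamma> * (lam * K * sqrt (real n)) + \<gamma> * (K * sqrt (real n)) * \<Omega> * s\<^sup>2 / 2
            = \<gamma> * (K * sqrt (real n) * (\<Omega> / 2 * (1 + s\<^sup>2) + lam))" by (simp add: field_simps)
        finally show "inner u (\<Sum>t=1..n. \<eta> (\<xi> t w)) \<le> K * sqrt (real n) * (\<Omega> / 2 * (1 + s\<^sup>2) + lam)"
          using \<gamma> by (simp only: mult_le_cancel_left_pos)
      qed
      with big show False by simp
    qed
  qed measurable
  moreover have "prob (E1 \<union> E2) \<le> prob E1 + prob E2" by (rule measure_Un_le) measurable
  ultimately show ?thesis by (simp add: \<Omega>_def)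
qed

section \<open>Subgradients of random convex functions\<close>

lemma convex_slope_mono:
  assumes cv: "convex_on UNIV (\<phi> :: 'a::real_vector \<Rightarrow> real)" and s: "0 < s" "s \<le> s'"
  shows "(\<phi> (x + s *\<^sub>R d) - \<phi> x) / s \<le> (\<phi> (x + s' *\<^sub>R d) - \<phi> x) / s'"
proof -
  define r where "r = s / s'"
  have r: "0 \<le> r" "r \<le> 1" "r * s' = s" "0 < r" using s by (auto simp: r_def)
  have "x + s *\<^sub>R d = (1 - r) *\<^sub>R x + r *\<^sub>R (x + s' *\<^sub>R d)" using r(3) by (simp add: algebra_simps)
  then have "\<phi> (x + s *\<^sub>R d) \<le> (1 - r) * \<phi> x + r * \<phi> (x + s' *\<^sub>R d)"
    using convex_onD[OF cv r(1,2), of x "x + s' *\<^sub>R d"] by simp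
  then have le: "\<phi> (x + s *\<^sub>R d) - \<phi> x \<le> r * (\<phi> (x + s' *\<^sub>R d) - \<phi> x)" by (simp add: algebra_simps)
  have "(\<phi> (x + s *\<^sub>R d) - \<phi> x) / s \<le> r * (\<phi> (x + s' *\<^sub>R d) - \<phi> x) / s"
    using le s(1) by (intro divide_right_mono) auto
  also have "\<dots> = (\<phi> (x + s' *\<^sub>R d) - \<phi> x) / s'" using s by (simp add: r_def)
  finally show ?thesis .
qed

text \<open>
  The same monotonicity of slopes, compared across the base point with the slope on the other side.
\<close>

lemma convex_slope_lower:
  assumes cv: "convex_on UNIV (\<phi> :: 'a::real_vector \<Rightarrow> real)" and s: "0 < s"
  shows "\<phi> x - \<phi> (x - d) \<le> (\<phi> (x + s *\<^sub>R d) - \<phi> x) / s"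
proof -
  define r where "r = s / (1 + s)"
  have r: "0 \<le> r" "r \<le> 1" "(1 - r) * s = r" using s by (auto simp: r_def field_simps)
  have "(1 - r) *\<^sub>R (x + s *\<^sub>R d) + r *\<^sub>R (x - d) = x + ((1 - r) * s - r) *\<^sub>R d" by (simp add: algebra_simps)
  then have "x = (1 - r) *\<^sub>R (x + s *\<^sub>R d) + r *\<^sub>R (x - d)" using r(3) by simp
  then have "\<phi> x \<le> (1 - r) * \<phi> (x + s *\<^sub>R d) + r * \<phi> (x - d)"
    using convex_onD[OF cv r(1,2), of "x + s *\<^sub>R d" "x - d"] by simp
  then have "(1 + s) * \<phi> x \<le> (1 + s) * ((1 - r) * \<phi> (x + s *\<^sub>R d) + r * \<phi> (x - d))"
    using s by (intro mult_left_mono) auto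
  also have "\<dots> = ((1 + s) * (1 - r)) * \<phi> (x + s *\<^sub>R d) + ((1 + s) * r) * \<phi> (x - d)" by (simp add: algebra_simps)
  also have "(1 + s) * (1 - r) = 1" using s by (simp add: r_def field_simps)
  also have "(1 + s) * r = s" using s by (simp add: r_def field_simps)
  finally show ?thesis using s by (simp add: field_simps)
qed

text \<open>
  If the directional derivatives along the coordinate axes are two-sided, they already determine a
  subgradient. The hypothesis states this through upper bounds alone, since convexity supplies the
  matching lower bounds. The point \<open>x - t d\<close> is the barycentre of points on the
  coordinate lines through \<open>x\<close>, so convexity bounds \<open>\<phi>\<close> there from
  above to first order. By convexity again, an upper bound at \<open>x - t d\<close> is a lower
  bound at \<open>x + d\<close>.
\<close>

lemma subgradient_from_partials:
  fixes \<phi> :: "'a::euclidean_space \<Rightarrow> real"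
  assumes cv: "convex_on UNIV \<phi>"
    and part: "\<And>b e. b \<in> Basis \<Longrightarrow> e > 0 \<Longrightarrow> \<exists>\<delta>>0. \<forall>s. \<bar>s\<bar> \<le> \<delta> \<longrightarrow> \<phi> (x + s *\<^sub>R b) - \<phi> x \<le> s * q b + e * \<bar>s\<bar>"
  shows "(\<Sum>b\<in>Basis. q b *\<^sub>R b) \<in> subdiff \<phi> x"
  unfolding subdiff_def
proof (intro CollectI allI)
  fix y :: 'a
  define d where "d = y - x"
  define g where "g = (\<Sum>b\<in>Basis. q b *\<^sub>R b)"
  define n where "n = real DIM('a)"
  have n: "n > 0" by (simp add: n_def)
  define C where "C = (\<Sum>b\<in>(Basis::'a set). \<bar>inner d b\<bar>)"
  have gd: "inner g d = (\<Sum>b\<in>Basis. q b * inner d b)"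
    by (simp add: g_def inner_sum_left inner_commute[of d])
  have main: "inner g d - e * C \<le> \<phi> y - \<phi> x" if e: "e > 0" for e
  proof -
    obtain \<delta> where \<delta>: "\<And>b. b \<in> Basis \<Longrightarrow> \<delta> b > 0"
      "\<And>b s. b \<in> Basis \<Longrightarrow> \<bar>s\<bar> \<le> \<delta> b \<Longrightarrow> \<phi> (x + s *\<^sub>R b) - \<phi> x \<le> s * q b + e * \<bar>s\<bar>"
      using part[OF _ e] by metis
    have "\<forall>b\<in>Basis. \<exists>t>0. t * n * \<bar>inner d b\<bar> \<le> \<delta> b"
    proof
      fix b :: 'a assume b: "b \<in> Basis"
      have "\<delta> b / (n * \<bar>inner d b\<bar> + 1) > 0" using \<delta>(1)[OF b] n by (intro divide_pos_pos add_nonneg_pos) auto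
      moreover have "\<delta> b / (n * \<bar>inner d b\<bar> + 1) * n * \<bar>inner d b\<bar> \<le> \<delta> b"
      proof -
        have "c / (c + 1) \<le> 1" if "c \<ge> 0" for c :: real using that by (simp add: divide_le_eq)
        from mult_left_mono[OF this, of "n * \<bar>inner d b\<bar>" "\<delta> b"] show ?thesis
          using \<delta>(1)[OF b] n by (simp add: mult.assoc)
      qed
      ultimately show "\<exists>t>0. t * n * \<bar>inner d b\<bar> \<le> \<delta> b" by blast
    qed
    then obtain T where T: "\<And>b. b \<in> Basis \<Longrightarrow> T b > 0" "\<And>b. b \<in> Basis \<Longrightarrow> T b * n * \<bar>inner d b\<bar> \<le> \<delta> b"
      by metis
    \<comment> \<open>The weights \<open>1 / n\<close> of the barycentre stretch the steps along the axes by the factor \<open>n\<close>.\<close>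
    define t where "t = Min (T ` Basis)"
    have t0: "t > 0" using T(1) by (simp add: t_def)
    have tb: "\<bar>- (t * n * inner d b)\<bar> \<le> \<delta> b" if b: "b \<in> Basis" for b
    proof -
      have "\<bar>- (t * n * inner d b)\<bar> = t * (n * \<bar>inner d b\<bar>)" using t0 n by (simp add: abs_mult)
      also have "\<dots> \<le> T b * (n * \<bar>inner d b\<bar>)" using n b by (intro mult_right_mono) (auto simp: t_def)
      also have "\<dots> \<le> \<delta> b" using T(2)[OF b] by (simp add: mult.assoc)
      finally show ?thesis .
    qed
    have "x - t *\<^sub>R d = (\<Sum>b\<in>Basis. (1/n) *\<^sub>R (x + (- (t * n * inner d b)) *\<^sub>R b))"
    proof -
      have "(\<Sum>b\<in>Basis. (1/n) *\<^sub>R (x + (- (t * n * inner d b)) *\<^sub>R b))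
          = (\<Sum>b\<in>(Basis::'a set). (1/n) *\<^sub>R x) - t *\<^sub>R (\<Sum>b\<in>Basis. inner d b *\<^sub>R b)"
        using n by (simp add: scaleR_sum_right sum_subtractf[symmetric] algebra_simps)
      also have "\<dots> = x - t *\<^sub>R d" by (simp add: euclidean_representation sum_constant_scaleR n_def)
      finally show ?thesis ..
    qed
    then have "\<phi> (x - t *\<^sub>R d) \<le> (\<Sum>b\<in>Basis. (1/n) * \<phi> (x + (- (t * n * inner d b)) *\<^sub>R b))"
      using convex_on_sum[OF finite_Basis nonempty_Basis cv, 
        where a = "\<lambda>_. 1/n" and y = "\<lambda>b. x + (- (t * n * inner d b)) *\<^sub>R b"] n by (simp add: n_def)
    also have "\<dots> \<le> (\<Sum>b\<in>Basis. (1/n) * (\<phi> x + (- (t * n * inner d b)) * q b + e * \<bar>- (t * n * inner d b)\<bar>))"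
      using n \<delta>(2)[OF _ tb] by (intro sum_mono mult_left_mono) (auto simp: algebra_simps)
    also have "\<dots> = (\<Sum>b\<in>(Basis::'a set). (1/n) * \<phi> x - t * (q b * inner d b) + t * e * \<bar>inner d b\<bar>)"
      using n t0 by (intro sum.cong refl) (simp add: field_simps abs_mult)
    also have "\<dots> = \<phi> x - t * inner g d + t * e * C"
      using n by (simp add: sum.distrib sum_subtractf gd C_def sum_distrib_left n_def)
    finally have up: "t * (inner g d - e * C) \<le> \<phi> x - \<phi> (x - t *\<^sub>R d)" by (simp add: algebra_simps)
    have "\<phi> x - \<phi> (x - t *\<^sub>R d) \<le> (\<phi> (x + (1/t) *\<^sub>R (t *\<^sub>R d)) - \<phi> x) / (1/t)"
      using t0 by (intro convex_slope_lower cv) auto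
    also have "\<dots> = t * (\<phi> y - \<phi> x)" using t0 by (simp add: d_def)
    finally have "t * (inner g d - e * C) \<le> t * (\<phi> y - \<phi> x)" using up by linarith
    then show ?thesis using t0 by (simp only: mult_le_cancel_left_pos)
  qed
  have "inner g d \<le> \<phi> y - \<phi> x + e" if e: "e > 0" for e
  proof -
    have C: "C \<ge> 0" by (simp add: C_def sum_nonneg)
    have "e / (C + 1) * C \<le> e" using C e by (simp add: field_simps)
    moreover have "e / (C + 1) > 0" using C e by simp
    ultimately show ?thesis using main[of "e / (C + 1)"] by linarith
  qed
  then have "inner g d \<le> \<phi> y - \<phi> x" by (rule field_le_epsilon)
  then show "\<phi> y \<ge> \<phi> x + inner (\<Sum>b\<in>Basis. q b *\<^sub>R b) (y - x)" by (simp add: g_def d_def)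
qed

text \<open>
  A measurable choice of subgradients whose mean is the gradient of the mean. Directional
  derivatives are decreasing limits of difference quotients, so by dominated convergence their means
  are the directional derivatives \<open>inner h d\<close> of the mean. Since \<open>inner h b +
  inner h (- b) = 0\<close> while the sum of the derivatives in the directions \<open>b\<close> and
  \<open>- b\<close> is nonnegative, that sum vanishes almost surely. Hence almost every function
  has two-sided partial derivatives, and these are limits of measurable functions.
\<close>

lemma AE_gradient:
  fixes G :: "'a::euclidean_space \<Rightarrow> 'b \<Rightarrow> real"
  assumes cv: "\<And>z. convex_on UNIV (\<lambda>x. G x z)"
    and int: "\<And>x. integrable P (G x)"
    and diff: "((\<lambda>x. integral\<^sup>L P (G x)) has_derivative (\<lambda>d. inner h d)) (at x)"
  obtains g where "g \<in> borel_measurable P" "AE z in P. g z \<in> subdiff (\<lambda>y. G y z) x"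
    "\<And>d. integrable P (\<lambda>z. inner (g z) d)" "\<And>d. (\<integral>z. inner (g z) d \<partial>P) = inner h d"
proof -
  define u where "u n = 1 / real (Suc n)" for n
  have u: "u n > 0" "u (Suc n) \<le> u n" for n by (simp_all add: u_def field_simps)
  have u_lim: "u \<longlonglongrightarrow> 0" unfolding u_def using LIMSEQ_inverse_real_of_nat by (simp add: inverse_eq_divide)
  define D where "D = (\<lambda>n d z. (G (x + u n *\<^sub>R d) z - G x z) / u n)"
  define p where "p d z = lim (\<lambda>n. D n d z)" for d z
  have [measurable]: "G y \<in> borel_measurable P" for y using int by (rule borel_measurable_integrable)
  have Dm[measurable]: "D n d \<in> borel_measurable P" for n d unfolding D_def by measurable
  have D_dec: "decseq (\<lambda>n. D n d z)" for d z
    unfolding D_def by (intro decseq_SucI convex_slope_mono[OF cv] u)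
  have D_low: "G x z - G (x - d) z \<le> D n d z" for n d z
    unfolding D_def by (intro convex_slope_lower[OF cv] u)
  have D_lim: "(\<lambda>n. D n d z) \<longlonglongrightarrow> p d z" for d z
  proof -
    obtain L where "(\<lambda>n. D n d z) \<longlonglongrightarrow> L" by (rule decseq_convergent[OF D_dec]) (use D_low in blast)
    then show ?thesis by (simp add: p_def limI)
  qed
  have p_le: "\<exists>n. D n d z \<le> p d z + e" if "e > 0" for d z e
  proof -
    have "\<forall>\<^sub>F n in sequentially. D n d z < p d z + e" 
      using order_tendstoD(2)[OF D_lim, of d z "p d z + e"] that by simp
    then have "\<exists>n. D n d z < p d z + e" by (rule eventually_happens'[rotated]) simp
    then show ?thesis using less_imp_le by blast
  qed
  \<comment> \<open>Monotonicity puts all quotients between the first one and the slope on the opposite side.\<close>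
  have bound: "\<bar>D n d z\<bar> \<le> \<bar>G (x + d) z - G x z\<bar> + \<bar>G x z - G (x - d) z\<bar>" for n d z
  proof -
    have "D n d z \<le> D 0 d z" using D_dec by (simp add: decseq_def)
    then show ?thesis using D_low[of z d n] by (simp add: D_def u_def)
  qed
  have dom: "integrable P (\<lambda>z. \<bar>G (x + d) z - G x z\<bar> + \<bar>G x z - G (x - d) z\<bar>)" for d
    using int by (intro Bochner_Integration.integrable_add integrable_abs Bochner_Integration.integrable_diff)
  have pm[measurable]: "p d \<in> borel_measurable P" for d
    by (rule borel_measurable_LIMSEQ_metric[OF Dm D_lim])
  have p_int: "integrable P (p d)" for d
    by (rule integrable_dominated_convergence[where s = "\<lambda>n. D n d", OF pm Dm dom[of d]]) (use D_lim bound in auto)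
  have ID: "(\<lambda>n. integral\<^sup>L P (D n d)) \<longlonglongrightarrow> integral\<^sup>L P (p d)" for d
    by (rule integral_dominated_convergence[where s = "\<lambda>n. D n d", OF pm Dm dom[of d]]) (use D_lim bound in auto)
  have p_mean: "integral\<^sup>L P (p d) = inner h d" for d
  proof (rule LIMSEQ_unique[OF ID])
    define k where "k = (\<lambda>s. integral\<^sup>L P (G (x + s *\<^sub>R d)))"
    have "((\<lambda>s. x + s *\<^sub>R d) has_derivative (\<lambda>s. s *\<^sub>R d)) (at 0)" by (auto intro!: derivative_eq_intros)
    from has_derivative_compose[OF this, of "\<lambda>x. integral\<^sup>L P (G x)" "\<lambda>d. inner h d"] diff
    have "(k has_derivative (\<lambda>s. inner h (s *\<^sub>R d))) (at 0)" by (simp add: k_def)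
    then have "(k has_field_derivative inner h d) (at 0)"
      by (simp add: has_field_derivative_def mult_commute_abs)
    then have "((\<lambda>s. (k s - k 0) / s) \<longlongrightarrow> inner h d) (at 0)"
      by (simp add: has_field_derivative_iff)
    moreover have "filterlim u (at 0) sequentially"
      unfolding filterlim_at using u_lim u(1) by (simp add: less_imp_neq[symmetric])
    ultimately have "(\<lambda>n. (k (u n) - k 0) / u n) \<longlonglongrightarrow> inner h d"
      by (rule filterlim_compose)
    moreover have "integral\<^sup>L P (D n d) = (k (u n) - k 0) / u n" for n
      using int by (simp add: D_def k_def)
    ultimately show "(\<lambda>n. integral\<^sup>L P (D n d)) \<longlonglongrightarrow> inner h d" by simp
  qed
  have p_pos: "0 \<le> p b z + p (- b) z" for b z
  proof (rule LIMSEQ_le_const[OF tendsto_add[OF D_lim D_lim]], intro exI[of _ 0] allI impI)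
    fix n
    have "x = (1 - 1/2) *\<^sub>R (x + u n *\<^sub>R b) + (1/2) *\<^sub>R (x + u n *\<^sub>R (- b))"
      by (simp add: algebra_simps flip: scaleR_add_left)
    then have "G x z \<le> (1 - 1/2) * G (x + u n *\<^sub>R b) z + (1/2) * G (x + u n *\<^sub>R (- b)) z"
      using convex_onD[OF cv[of z], of "1/2" "x + u n *\<^sub>R b" "x + u n *\<^sub>R (- b)"] by simp
    then have "0 \<le> (G (x + u n *\<^sub>R b) z - G x z + (G (x + u n *\<^sub>R (- b)) z - G x z)) / u n"
      using u(1)[of n] by (intro divide_nonneg_pos) auto
    then show "0 \<le> D n b z + D n (- b) z" by (simp only: D_def add_divide_distrib)
  qed
  have "AE z in P. p b z + p (- b) z = 0" for b
    using p_pos p_int p_mean by (subst integral_nonneg_eq_0_iff_AE[symmetric]) auto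
  then have AE: "AE z in P. \<forall>b\<in>Basis. p b z + p (- b) z = 0" by (intro AE_finite_allI) auto
  define g where "g z = (\<Sum>b\<in>Basis. p b z *\<^sub>R b)" for z
  have gd: "inner (g z) d = (\<Sum>b\<in>Basis. p b z * inner b d)" for z d by (simp add: g_def inner_sum_left)
  show ?thesis
  proof
    show "g \<in> borel_measurable P" unfolding g_def by measurable
    show "integrable P (\<lambda>z. inner (g z) d)" for d unfolding gd using p_int by simp
    show "(\<integral>z. inner (g z) d \<partial>P) = inner h d" for d
      unfolding gd using p_int by (simp add: p_mean euclidean_inner[of h d] inner_commute[of d])
    show "AE z in P. g z \<in> subdiff (\<lambda>y. G y z) x"
      using AE
    proof eventually_elim
      case (elim z)
      show ?case unfolding g_def
      proof (rule subgradient_from_partials[OF cv])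
        fix b :: 'a and e :: real assume b: "b \<in> Basis" and e: "e > 0"
        obtain n1 n2 where n1: "D n1 b z \<le> p b z + e" and n2: "D n2 (- b) z \<le> p (- b) z + e"
          using p_le[OF e] by metis
        have one: "G (x + s *\<^sub>R d) z - G x z \<le> s * q"
          if "0 < s" "s \<le> u n" "D n d z \<le> q" for s n q d
        proof -
          have "(G (x + s *\<^sub>R d) z - G x z) / s \<le> D n d z"
            unfolding D_def using that by (intro convex_slope_mono[OF cv])
          then show ?thesis using that by (simp add: field_simps order_trans)
        qed
        show "\<exists>\<delta>>0. \<forall>s. \<bar>s\<bar> \<le> \<delta> \<longrightarrow> G (x + s *\<^sub>R b) z - G x z \<le> s * p b z + e * \<bar>s\<bar>"
        proof (intro exI[of _ "min (u n1) (u n2)"] conjI allI impI)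
          show "0 < min (u n1) (u n2)" using u by simp
          fix s assume s: "\<bar>s\<bar> \<le> min (u n1) (u n2)"
          consider "s = 0" | "s > 0" | "s < 0" by linarith
          then show "G (x + s *\<^sub>R b) z - G x z \<le> s * p b z + e * \<bar>s\<bar>"
          proof cases
            case 2
            then show ?thesis using one[OF 2 _ n1] s by (simp add: algebra_simps)
          next
            case 3
            have "p (- b) z = - p b z" using elim b by (simp add: add_eq_0_iff2)
            then show ?thesis using one[OF _ _ n2, of "- s"] s 3 by (simp add: algebra_simps)
          qed simp
        qed
      qed
    qed
  qed
qed

lemma derivative_in_subdiff:
  fixes \<phi> :: "'a::euclidean_space \<Rightarrow> real"
  assumes cv: "convex_on UNIV \<phi>" and der: "(\<phi> has_derivative (\<lambda>d. inner h d)) (at x)"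
  shows "h \<in> subdiff \<phi> x"
  unfolding subdiff_def
proof (intro CollectI allI)
  fix y
  define d where "d = y - x"
  have seg: "((\<lambda>t. x + t *\<^sub>R d) has_derivative (\<lambda>t. t *\<^sub>R d)) (at 0)"
    by (auto intro!: derivative_eq_intros)
  have "((\<lambda>t. \<phi> (x + t *\<^sub>R d)) has_derivative (\<lambda>t. inner h (t *\<^sub>R d))) (at 0)"
    by (rule has_derivative_compose[OF seg]) (use der in simp)
  then have "((\<lambda>t. \<phi> (x + t *\<^sub>R d)) has_field_derivative inner h d) (at 0)"
    by (simp add: has_field_derivative_def mult_commute_abs)
  then have "((\<lambda>t. (\<phi> (x + t *\<^sub>R d) - \<phi> x) / t) \<longlongrightarrow> inner h d) (at 0)"
    by (simp add: has_field_derivative_iff)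
  then have "((\<lambda>t. (\<phi> (x + t *\<^sub>R d) - \<phi> x) / t) \<longlongrightarrow> inner h d) (at_right 0)"
    by (rule tendsto_within_subset) simp
  then have "inner h d \<le> \<phi> y - \<phi> x"
  proof (rule tendsto_upperbound)
    show "\<forall>\<^sub>F t in at_right 0. (\<phi> (x + t *\<^sub>R d) - \<phi> x) / t \<le> \<phi> y - \<phi> x"
      using convex_slope_mono[OF cv, of _ 1 x d]
      by (auto simp: eventually_at_right[of 0 1] d_def intro!: exI[of _ 1])
  qed simp
  then show "\<phi> y \<ge> \<phi> x + inner h (y - x)" by (simp add: d_def)
qed

lemma differentiable_gradient:
  fixes \<phi> :: "'a::euclidean_space \<Rightarrow> real"
  assumes "\<phi> differentiable (at x)"
  obtains h where "(\<phi> has_derivative (\<lambda>d. inner h d)) (at x)"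
proof -
  obtain D where D: "(\<phi> has_derivative D) (at x)" using assms by (auto simp: differentiable_def)
  have "linear D" using D by (simp add: has_derivative_linear)
  have "D d = inner (\<Sum>b\<in>Basis. D b *\<^sub>R b) d" for d
  proof -
    have "D d = D (\<Sum>b\<in>Basis. inner d b *\<^sub>R b)" by (simp add: euclidean_representation)
    also have "\<dots> = (\<Sum>b\<in>Basis. inner d b * D b)"
      using \<open>linear D\<close> by (simp add: linear_sum linear_cmul)
    also have "\<dots> = inner (\<Sum>b\<in>Basis. D b *\<^sub>R b) d"
      by (simp add: inner_sum_left inner_commute[of d] mult.commute)
    finally show ?thesis .
  qed
  then have "D = (\<lambda>d. inner (\<Sum>b\<in>Basis. D b *\<^sub>R b) d)" by blast
  with D that show ?thesis by metis
qed

text \<open>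
  Testing the subgradient inequality in the directions \<open>b\<close> and \<open>- b\<close>
  bounds each coordinate.
\<close>

lemma subdiff_bounded:
  fixes \<phi> :: "'a::euclidean_space \<Rightarrow> real"
  obtains C where "\<And>g. g \<in> subdiff \<phi> x \<Longrightarrow> norm g \<le> C"
proof
  fix g assume "g \<in> subdiff \<phi> x"
  then have g: "inner g d \<le> \<phi> (x + d) - \<phi> x" for d
  proof -
    have "\<phi> x + inner g (x + d - x) \<le> \<phi> (x + d)" using \<open>g \<in> subdiff \<phi> x\<close> unfolding subdiff_def by blast
    then show ?thesis by simp
  qed
  have "norm g \<le> (\<Sum>b\<in>Basis. \<bar>inner g b\<bar>)" by (rule norm_le_l1)
  also have "\<dots> \<le> (\<Sum>b\<in>Basis. \<bar>\<phi> (x + b) - \<phi> x\<bar> + \<bar>\<phi> (x - b) - \<phi> x\<bar>)"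
  proof (rule sum_mono)
    fix b :: 'a
    show "\<bar>inner g b\<bar> \<le> \<bar>\<phi> (x + b) - \<phi> x\<bar> + \<bar>\<phi> (x - b) - \<phi> x\<bar>"
      using g[of b] g[of "- b"] by simp
  qed
  finally show "norm g \<le> (\<Sum>b\<in>Basis. \<bar>\<phi> (x + b) - \<phi> x\<bar> + \<bar>\<phi> (x - b) - \<phi> x\<bar>)" .
qed

text \<open>
  The point is that the supremum is over a bounded set, as a supremum of an unbounded set of reals
  would carry no information.
\<close>

lemma dual_norm_le_subgrad_dev:
  fixes nrm :: "'a::euclidean_space \<Rightarrow> real"
  assumes nrm: "is_norm nrm" and i: "i \<le> m"
    and g: "g \<in> subdiff (\<lambda>y. F i y z) x" and h: "h \<in> subdiff (mean_fun P F i) x"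
  shows "dual_norm nrm (g - h) \<le> subgrad_dev nrm P F m x z"
  unfolding subgrad_dev_def
proof (rule cSup_upper)
  show "dual_norm nrm (g - h) \<in> {dual_norm nrm (g - h) | i g h.
      i \<le> m \<and> g \<in> subdiff (\<lambda>y. F i y z) x \<and> h \<in> subdiff (mean_fun P F i) x}"
    using i g h by blast
  obtain k where k: "k > 0" "\<And>x. k * norm x \<le> nrm x" using is_norm_ge_norm[OF nrm] by blast
  have dual_le: "dual_norm nrm v \<le> norm v / k" for v
  proof (rule dual_norm_least[OF nrm])
    fix u assume u: "nrm u \<le> 1"
    have "norm u \<le> 1 / k" using k(2)[of u] u k(1) by (simp add: field_simps)
    then have "norm u * norm v \<le> 1 / k * norm v" by (rule mult_right_mono) simp
    then show "inner u v \<le> norm v / k" using norm_cauchy_schwarz[of u v] by simp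
  qed
  have "\<exists>C. \<forall>g. g \<in> subdiff (\<lambda>y. F i y z) x \<longrightarrow> norm g \<le> C" for i using subdiff_bounded by metis
  then obtain C where C: "\<And>i g. g \<in> subdiff (\<lambda>y. F i y z) x \<Longrightarrow> norm g \<le> C i" by metis
  have "\<exists>D. \<forall>h. h \<in> subdiff (mean_fun P F i) x \<longrightarrow> norm h \<le> D" for i using subdiff_bounded by metis
  then obtain D where D: "\<And>i h. h \<in> subdiff (mean_fun P F i) x \<Longrightarrow> norm h \<le> D i" by metis
  show "bdd_above {dual_norm nrm (g - h) | i g h.
      i \<le> m \<and> g \<in> subdiff (\<lambda>y. F i y z) x \<and> h \<in> subdiff (mean_fun P F i) x}"
  proof (rule bdd_aboveI, safe)
    fix i g h assume i: "i \<le> m" and gh: "g \<in> subdiff (\<lambda>y. F i y z) x" "h \<in> subdiff (mean_fun P F i) x"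
    have "norm (g - h) \<le> C i + D i" using norm_triangle_ineq4[of g h] C[OF gh(1)] D[OF gh(2)] by linarith
    also have "\<dots> \<le> (MAX i\<in>{..m}. C i + D i)" using i by (intro Max_ge) auto
    finally have "norm (g - h) / k \<le> (MAX i\<in>{..m}. C i + D i) / k" using k(1) by (simp add: divide_right_mono)
    then show "dual_norm nrm (g - h) \<le> (MAX i\<in>{..m}. C i + D i) / k" using dual_le[of "g - h"] by linarith
  qed
qed

section \<open>Optimality conditions for a finite maximum\<close>

text \<open>
  A separation argument in two stages. The convex hull of the gradients misses the dual cone
  \<open>K\<close> of \<open>X - x\<close>, so some \<open>d\<close> is strictly negative on the
  hull and nonnegative on \<open>K\<close>. By the bipolar argument \<open>d\<close> lies in the
  closed cone generated by \<open>X - x\<close>; as the hull condition is open, a genuine feasible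
  direction does the same.
\<close>

lemma common_descent_direction:
  fixes h :: "'i \<Rightarrow> 'a::euclidean_space"
  assumes X: "convex X" "x \<in> X" and A: "finite A" "A \<noteq> {}"
    and none: "\<And>k. k \<in> convex hull (h ` A) \<Longrightarrow> \<exists>u\<in>X. inner k (u - x) < 0"
  shows "\<exists>u\<in>X. \<forall>i\<in>A. inner (h i) (u - x) < 0"
proof -
  define K where "K = (\<Inter>u\<in>X. {k. 0 \<le> inner k (u - x)})"
  have K: "convex K" "closed K"
    unfolding K_def by (auto intro!: convex_INT closed_INT convex_halfspace_ge closed_halfspace_ge simp: inner_commute[of _ "_ - x"])
  have K0: "0 \<in> K" by (simp add: K_def)
  have Kr: "r *\<^sub>R k \<in> K" if "k \<in> K" "0 \<le> r" for k r using that by (simp add: K_def)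
  have "K \<inter> convex hull (h ` A) = {}" using none by (force simp: K_def)
  moreover have "compact (convex hull (h ` A))" "convex hull (h ` A) \<noteq> {}"
    using A by (simp_all add: finite_imp_compact_convex_hull)
  ultimately obtain a b where ab: "\<And>k. k \<in> K \<Longrightarrow> inner a k < b" "\<And>k. k \<in> convex hull (h ` A) \<Longrightarrow> inner a k > b"
    using separating_hyperplane_closed_compact[OF K convex_convex_hull, of "h ` A"] by blast
  have b: "b > 0" using ab(1)[OF K0] by simp
  \<comment> \<open>Boundedness above on a cone forces the sign.\<close>
  have aK: "inner a k \<le> 0" if k: "k \<in> K" for k
  proof (rule ccontr)
    assume "\<not> inner a k \<le> 0"
    moreover from this have "inner a ((b / inner a k) *\<^sub>R k) < b"
      using b k by (intro ab Kr) auto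
    ultimately show False by simp
  qed
  define d where "d = - a"
  have dh: "inner (h i) d < 0" if "i \<in> A" for i
    using ab(2)[OF hull_inc, of "h i"] that b by (simp add: d_def inner_commute)
  define T where "T = closure (cone hull ((\<lambda>u. u - x) ` X))"
  have cT: "convex T" unfolding T_def
    using X(1) convex_translation_subtract[OF X(1), of x] by (intro convex_closure convex_cone_hull) simp
  have clT: "closed T" by (simp add: T_def)
  have inT: "r *\<^sub>R (u - x) \<in> T" if "u \<in> X" "0 \<le> r" for u r
    unfolding T_def using that by (intro subsetD[OF closure_subset]) (auto simp: cone_hull_expl)
  have "d \<in> T"
  proof (rule ccontr)
    assume "d \<notin> T"
    then obtain k c where kc: "inner k d < c" "\<And>t. t \<in> T \<Longrightarrow> inner k t > c"
      using separating_hyperplane_closed_point[OF cT clT] by blast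
    have c: "c < 0" using kc(2)[OF inT[OF X(2), of 0]] by simp
    have "0 \<le> inner k (u - x)" if u: "u \<in> X" for u
    proof (rule ccontr)
      assume neg: "\<not> 0 \<le> inner k (u - x)"
      have "c < inner k ((c / inner k (u - x)) *\<^sub>R (u - x))"
        using neg c u by (intro kc inT) (auto simp: zero_le_divide_iff)
      then show False using neg by simp
    qed
    then have "k \<in> K" by (simp add: K_def)
    then show False using aK[of k] kc(1) c by (simp add: d_def inner_commute)
  qed
  moreover have "open (\<Inter>i\<in>A. {v. inner (h i) v < 0})"
    using A by (intro open_INT ballI open_halfspace_lt) auto
  ultimately have "(\<Inter>i\<in>A. {v. inner (h i) v < 0}) \<inter> cone hull ((\<lambda>u. u - x) ` X) \<noteq> {}"
    using dh unfolding T_def by (subst open_Int_closure_eq_empty[symmetric]) auto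
  then obtain v where v: "v \<in> cone hull ((\<lambda>u. u - x) ` X)" "\<And>i. i \<in> A \<Longrightarrow> inner (h i) v < 0" by blast
  then obtain r u where ru: "u \<in> X" "r \<ge> 0" "v = r *\<^sub>R (u - x)" by (auto simp: cone_hull_expl)
  have "inner (h i) (u - x) < 0" if "i \<in> A" for i
    using v(2)[OF that] ru(2,3) by (auto simp: mult_less_0_iff)
  then show ?thesis using ru(1) by blast
qed

text \<open>
  The hull of a finite set consists of weighted sums over its points. Weights on the indices require
  choosing one index for each point, since \<open>h\<close> need not be injective.
\<close>

lemma convex_hull_image_weights:
  fixes h :: "'i \<Rightarrow> 'a::real_vector"
  assumes A: "finite A" and k: "k \<in> convex hull (h ` A)"
  obtains y where "\<And>i. 0 \<le> y i" "\<And>i. i \<notin> A \<Longrightarrow> y i = (0::real)" "sum y A = 1" "k = (\<Sum>i\<in>A. y i *\<^sub>R h i)"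
proof -
  obtain A' where A': "A' \<subseteq> A" "inj_on h A'" "h ` A = h ` A'"
    using subset_image_inj[of "h ` A" h A] by auto
  have fin: "finite A'" using A' A finite_subset by blast
  obtain u where u: "\<forall>x\<in>h ` A'. 0 \<le> u x" "sum u (h ` A') = 1" "(\<Sum>x\<in>h ` A'. u x *\<^sub>R x) = k"
    using k fin unfolding A'(3) by (subst (asm) convex_hull_finite) auto
  define y where "y i = (if i \<in> A' then u (h i) else 0)" for i
  show ?thesis
  proof
    show "0 \<le> y i" for i using u(1) by (simp add: y_def)
    show "y i = 0" if "i \<notin> A" for i using that A'(1) by (auto simp: y_def)
    have "sum y A = (\<Sum>i\<in>A'. u (h i))"
      using A' A by (intro sum.mono_neutral_cong_right) (auto simp: y_def)
    then show "sum y A = 1" using u(2) A'(2) by (simp add: sum.reindex)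
    have "(\<Sum>i\<in>A. y i *\<^sub>R h i) = (\<Sum>i\<in>A'. u (h i) *\<^sub>R h i)"
      using A' A by (intro sum.mono_neutral_cong_right) (auto simp: y_def)
    then show "k = (\<Sum>i\<in>A. y i *\<^sub>R h i)" using u(3) A'(2) by (simp add: sum.reindex)
  qed
qed

text \<open>
  Only indices that attain the maximum receive weight, which is why the weighted sum of the values
  is the optimal value. If no convex combination of their gradients were nonnegative on the feasible
  directions, a common descent direction would decrease all active functions at once, and the
  inactive ones stay below the maximum for a small step.
\<close>

lemma minimax_multipliers:
  fixes f :: "'i \<Rightarrow> 'a::euclidean_space \<Rightarrow> real"
  assumes X: "convex X" "x \<in> X" and I: "finite I" "I \<noteq> {}"
    and opt: "\<And>u. u \<in> X \<Longrightarrow> (MAX i\<in>I. f i x) \<le> (MAX i\<in>I. f i u)"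
    and der: "\<And>i. i \<in> I \<Longrightarrow> (f i has_derivative (\<lambda>d. inner (h i) d)) (at x)"
  obtains y where "\<And>i. 0 \<le> y i" "sum y I = 1" "(\<Sum>i\<in>I. y i * f i x) = (MAX i\<in>I. f i x)"
    "\<And>u. u \<in> X \<Longrightarrow> 0 \<le> inner (\<Sum>i\<in>I. y i *\<^sub>R h i) (u - x)"
proof -
  define V where "V = (MAX i\<in>I. f i x)"
  define A where "A = {i\<in>I. f i x = V}"
  have "V \<in> (\<lambda>i. f i x) ` I" unfolding V_def using I by (intro Max_in) auto
  then have A: "finite A" "A \<noteq> {}" "A \<subseteq> I" using I by (auto simp: A_def)
  have leV: "f i x \<le> V" if "i \<in> I" for i using that I by (simp add: V_def)
  have "\<exists>k\<in>convex hull (h ` A). \<forall>u\<in>X. 0 \<le> inner k (u - x)"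
  proof (rule ccontr)
    assume "\<not> ?thesis"
    then have "\<exists>u\<in>X. inner k (u - x) < 0" if "k \<in> convex hull (h ` A)" for k
      using that by (auto simp: not_le)
    then obtain u where u: "u \<in> X" "\<And>i. i \<in> A \<Longrightarrow> inner (h i) (u - x) < 0"
      using common_descent_direction[OF X A(1,2)] by blast
    have "\<forall>\<^sub>F t in at_right 0. f i (x + t *\<^sub>R (u - x)) < V" if i: "i \<in> I" for i
    proof -
      have seg: "((\<lambda>t. x + t *\<^sub>R (u - x)) has_derivative (\<lambda>t. t *\<^sub>R (u - x))) (at 0)"
        by (auto intro!: derivative_eq_intros)
      have "((\<lambda>t. f i (x + t *\<^sub>R (u - x))) has_derivative (\<lambda>t. inner (h i) (t *\<^sub>R (u - x)))) (at 0)"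
        by (rule has_derivative_compose[OF seg]) (use der[OF i] in simp)
      then have D: "((\<lambda>t. f i (x + t *\<^sub>R (u - x))) has_field_derivative inner (h i) (u - x)) (at 0)"
        by (simp add: has_field_derivative_def mult_commute_abs)
      show ?thesis
      proof (cases "i \<in> A")
        case True
        from DERIV_neg_dec_right[OF D u(2)[OF True]] obtain e where
          "e > 0" "\<forall>t>0. t < e \<longrightarrow> f i (x + t *\<^sub>R (u - x)) < f i x" by auto
        then show ?thesis using True by (auto simp: A_def eventually_at_right[of 0 1] intro!: exI[of _ e])
      next
        case False
        then have lt: "f i x < V" using leV[OF i] i by (simp add: A_def)
        have "((\<lambda>t. f i (x + t *\<^sub>R (u - x))) \<longlongrightarrow> f i x) (at_right 0)"
          using DERIV_isCont[OF D] by (auto simp: isCont_def intro: tendsto_within_subset)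
        from order_tendstoD(2)[OF this lt] show ?thesis .
      qed
    qed
    then have "\<forall>\<^sub>F t in at_right 0. \<forall>i\<in>I. f i (x + t *\<^sub>R (u - x)) < V"
      using I by (simp add: eventually_ball_finite)
    moreover have "\<forall>\<^sub>F t::real in at_right 0. t < 1 \<and> 0 < t"
      by (auto simp: eventually_at_right[of 0 1] intro!: exI[of _ 1])
    ultimately have "\<forall>\<^sub>F t::real in at_right 0. (\<forall>i\<in>I. f i (x + t *\<^sub>R (u - x)) < V) \<and> t < 1 \<and> 0 < t"
      by (rule eventually_conj)
    from eventually_happens'[OF _ this]
    obtain t :: real where t: "0 < t" "t < 1" "\<And>i. i \<in> I \<Longrightarrow> f i (x + t *\<^sub>R (u - x)) < V" by auto
    have "x + t *\<^sub>R (u - x) = (1 - t) *\<^sub>R x + t *\<^sub>R u" by (simp add: algebra_simps)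
    then have "x + t *\<^sub>R (u - x) \<in> X" using convexD_alt[OF X(1) X(2) u(1), of t] t by simp
    from opt[OF this] t(3) I show False by (simp add: V_def[symmetric] Max_ge_iff) (force simp: not_le[symmetric])
  qed
  then obtain k where k: "k \<in> convex hull (h ` A)" "\<And>u. u \<in> X \<Longrightarrow> 0 \<le> inner k (u - x)" by blast
  obtain y where y: "\<And>i. 0 \<le> y i" "\<And>i. i \<notin> A \<Longrightarrow> y i = 0" "sum y A = 1" "k = (\<Sum>i\<in>A. y i *\<^sub>R h i)"
    using convex_hull_image_weights[OF A(1) k(1)] by blast
  show ?thesis
  proof
    show "0 \<le> y i" for i by (rule y)
    show s: "sum y I = 1"
      using y(2,3) A(3) I by (subst sum.mono_neutral_right[of I A]) auto
    have "(\<Sum>i\<in>I. y i * f i x) = (\<Sum>i\<in>I. y i * V)"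
      using y(2) by (intro sum.cong refl) (auto simp: A_def)
    also have "\<dots> = V" using s by (simp flip: sum_distrib_right)
    finally show "(\<Sum>i\<in>I. y i * f i x) = (MAX i\<in>I. f i x)" by (simp add: V_def)
    have "(\<Sum>i\<in>I. y i *\<^sub>R h i) = k"
      using y(2,4) A(3) I by (subst sum.mono_neutral_right[of I A]) auto
    then show "0 \<le> inner (\<Sum>i\<in>I. y i *\<^sub>R h i) (u - x)" if "u \<in> X" for u using k(2)[OF that] by simp
  qed
qed

section \<open>Minimax values and the support of a measure\<close>

text \<open>
  Reduces the infimum over \<open>X\<close> to a countable one, which is what makes optimal values
  measurable in the sample.
\<close>

lemma cINF_dense_subset:
  fixes \<phi> :: "'a::metric_space \<Rightarrow> real"
  assumes cont: "continuous_on X \<phi>" and X: "compact X" "X \<noteq> {}" and T: "T \<subseteq> X" "X \<subseteq> closure T"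
  shows "(INF x\<in>X. \<phi> x) = (INF x\<in>T. \<phi> x)"
proof (rule antisym)
  have Tne: "T \<noteq> {}" using X T by auto
  have bdd: "bdd_below (\<phi> ` X)"
    using X cont by (intro bounded_imp_bdd_below compact_imp_bounded compact_continuous_image)
  show "(INF x\<in>X. \<phi> x) \<le> (INF x\<in>T. \<phi> x)" using Tne bdd T(1) by (intro cINF_superset_mono) auto
  have bddT: "bdd_below (\<phi> ` T)" using bdd T(1) by (meson bdd_below_mono image_mono)
  show "(INF x\<in>T. \<phi> x) \<le> (INF x\<in>X. \<phi> x)"
  proof (rule cINF_greatest[OF X(2)])
    fix x assume x: "x \<in> X"
    then have "x \<in> closure T" using T by blast
    then obtain s where s: "\<And>n. s n \<in> T" "s \<longlonglongrightarrow> x" by (auto simp: closure_sequential)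
    have "(\<lambda>n. \<phi> (s n)) \<longlonglongrightarrow> \<phi> x"
      using continuous_on_tendsto_compose[OF cont s(2) x] s(1) T(1) by (auto intro: always_eventually)
    then show "(INF x\<in>T. \<phi> x) \<le> \<phi> x"
      by (rule LIMSEQ_le_const) (use s(1) bddT in \<open>auto intro: cINF_lower\<close>)
  qed
qed

lemma continuous_on_MAX:
  fixes \<Phi> :: "'i \<Rightarrow> 'a::topological_space \<Rightarrow> real"
  assumes "finite I" "I \<noteq> {}" "\<And>i. i \<in> I \<Longrightarrow> continuous_on X (\<Phi> i)"
  shows "continuous_on X (\<lambda>x. MAX i\<in>I. \<Phi> i x)"
  using assms by (induction I rule: finite_ne_induct) (auto intro: continuous_on_max)

lemma minimax_value_measurable:
  fixes X :: "'a::euclidean_space set" and \<Phi> :: "'w \<Rightarrow> nat \<Rightarrow> 'a \<Rightarrow> real"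
  assumes X: "compact X" "X \<noteq> {}" and m: "1 \<le> m"
    and cont: "\<And>w i. i \<in> {1..m} \<Longrightarrow> continuous_on X (\<Phi> w i)"
    and meas: "\<And>i x. i \<in> {1..m} \<Longrightarrow> x \<in> X \<Longrightarrow> (\<lambda>w. \<Phi> w i x) \<in> borel_measurable M"
  shows "(\<lambda>w. minimax_value X m (\<Phi> w)) \<in> borel_measurable M"
proof -
  obtain T where T: "countable T" "T \<subseteq> X" "X \<subseteq> closure T" using separable[of X] by blast
  have ne: "{1..m} \<noteq> {}" using m by simp
  have cM: "continuous_on X (\<lambda>x. MAX i\<in>{1..m}. \<Phi> w i x)" for w
    using cont by (intro continuous_on_MAX) (use ne in auto)
  have "(\<lambda>w. minimax_value X m (\<Phi> w)) = (\<lambda>w. INF x\<in>T. MAX i\<in>{1..m}. \<Phi> w i x)"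
    unfolding minimax_value_def using cINF_dense_subset[OF cM X T(2,3)] by blast
  moreover have "(\<lambda>w. INF x\<in>T. MAX i\<in>{1..m}. \<Phi> w i x) \<in> borel_measurable M"
  proof (rule borel_measurable_cINF[OF T(1)])
    show "(\<lambda>w. MAX i\<in>{1..m}. \<Phi> w i x) \<in> borel_measurable M" if "x \<in> T" for x
      using that T(2) by (intro borel_measurable_Max meas) auto
    show "bdd_below ((\<lambda>x. MAX i\<in>{1..m}. \<Phi> w i x) ` T)" for w
      using bounded_imp_bdd_below[OF compact_imp_bounded[OF compact_continuous_image[OF cM X(1)]], of w] T(2)
      by (meson bdd_below_mono image_mono)
  qed
  ultimately show ?thesis by simp
qed

text \<open>
  The infimum in the definition of the value is a minimum, and so really is a lower bound for all
  points of \<open>X\<close>.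
\<close>

lemma minimax_value_attained:
  fixes X :: "'a::euclidean_space set" and \<Phi> :: "nat \<Rightarrow> 'a \<Rightarrow> real"
  assumes X: "compact X" "X \<noteq> {}" and m: "1 \<le> m" and cont: "\<And>i. i \<in> {1..m} \<Longrightarrow> continuous_on X (\<Phi> i)"
  obtains x where "x \<in> X" "minimax_value X m \<Phi> = (MAX i\<in>{1..m}. \<Phi> i x)"
    "\<And>u. u \<in> X \<Longrightarrow> minimax_value X m \<Phi> \<le> (MAX i\<in>{1..m}. \<Phi> i u)"
proof -
  have ne: "{1..m} \<noteq> {}" using m by simp
  have cM: "continuous_on X (\<lambda>x. MAX i\<in>{1..m}. \<Phi> i x)"
    using cont by (intro continuous_on_MAX) (use ne in auto)
  obtain x where x: "x \<in> X" "\<And>u. u \<in> X \<Longrightarrow> (MAX i\<in>{1..m}. \<Phi> i x) \<le> (MAX i\<in>{1..m}. \<Phi> i u)"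
    using continuous_attains_inf[OF X cM] by blast
  have "minimax_value X m \<Phi> = (MAX i\<in>{1..m}. \<Phi> i x)"
    unfolding minimax_value_def using x by (intro cInf_eq_minimum) auto
  with x that show ?thesis by simp
qed

lemma msupport_closed: "closed (msupport (P :: 'b::topological_space measure))"
proof -
  have "- msupport P = \<Union>{U. open U \<and> emeasure P U = 0}"
    by (auto simp: msupport_def zero_less_iff_neq_zero)
  moreover have "open (\<Union>{U. open U \<and> emeasure P U = 0})" by auto
  ultimately show ?thesis by (simp add: closed_def)
qed

text \<open>
  The complement of the support is a union of open null sets, and by the Lindelof property countably
  many of them suffice.
\<close>

lemma AE_msupport:
  fixes P :: "'b::second_countable_topology measure"
  assumes "sets P = sets borel"
  shows "AE z in P. z \<in> msupport P"
proof -
  define \<U> where "\<U> = {U. open U \<and> emeasure P U = 0}"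
  obtain \<U>' where \<U>': "\<U>' \<subseteq> \<U>" "countable \<U>'" "\<Union>\<U>' = \<Union>\<U>"
    using Lindelof[of \<U>] by (auto simp: \<U>_def)
  have "(\<Union>U\<in>\<U>'. U) \<in> null_sets P"
    using \<U>' assms by (intro null_sets_UN' null_setsI) (auto simp: \<U>_def)
  moreover have "- msupport P = \<Union>\<U>"
    by (auto simp: msupport_def \<U>_def zero_less_iff_neq_zero)
  ultimately have "- msupport P \<in> null_sets P" using \<U>'(3) by simp
  then show ?thesis by (rule AE_I') auto
qed

section \<open>Confidence bounds for the sample average approximation\<close>

theorem proposition5:
  fixes nrm :: "'a::euclidean_space \<Rightarrow> real"
    and \<omega> :: "'a \<Rightarrow> real"
    and grad\<omega> :: "'a \<Rightarrow> 'a"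
    and X :: "'a set"
    and P :: "(real ^ 'k) measure"
    and F :: "nat \<Rightarrow> 'a \<Rightarrow> real ^ 'k \<Rightarrow> real"
    and f :: "nat \<Rightarrow> 'a \<Rightarrow> real"
    and m N :: nat
    and M :: "'w measure"
    and \<xi> :: "nat \<Rightarrow> 'w \<Rightarrow> real ^ 'k"
    and M1 M2 s \<mu> lam R \<Omega> Opt :: real
    and OptN :: "'w \<Rightarrow> real"
    and \<Xi> :: "(real ^ 'k) set"
  defines "\<Xi> \<equiv> msupport P"
    and "f \<equiv> mean_fun P F"
    and "R \<equiv> min_radius nrm X"
    and "\<Omega> \<equiv> Omega_const nrm \<omega>"
    and "Opt \<equiv> minimax_value X m (mean_fun P F)"
    and "OptN \<equiv> (\<lambda>w. minimax_value X m (saa_fun F N (\<lambda>t. \<xi> t w)))"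
  assumes nrm: "is_norm nrm"
    and \<omega>_deriv: "\<forall>x\<in>unit_ball nrm.
        (\<omega> has_derivative (\<lambda>d. inner (grad\<omega> x) d)) (at x within unit_ball nrm)"
    and \<omega>_C1: "continuous_on (unit_ball nrm) grad\<omega>"
    and \<omega>_strongly_convex: "\<forall>x\<in>unit_ball nrm. \<forall>y\<in>unit_ball nrm.
        inner (grad\<omega> x - grad\<omega> y) (x - y) \<ge> (nrm (x - y))\<^sup>2"
    and \<omega>_0: "\<omega> 0 = 0" "grad\<omega> 0 = 0"
    and X: "X \<noteq> {}" "convex X" "compact X"
    and P: "prob_space P" "sets P = sets borel"
    and m: "1 \<le> m"
    and F_borel: "\<forall>i\<le>m. (\<lambda>(x, z). F i x z) \<in> borel_measurable (restrict_space borel (UNIV \<times> \<Xi>))"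
    and F_convex: "\<forall>i\<le>m. \<forall>z\<in>\<Xi>. convex_on UNIV (\<lambda>x. F i x z)"
    and F_summable: "\<forall>i\<le>m. \<forall>x. set_integrable P \<Xi> (\<lambda>z. F i x z)"
    and M: "prob_space M"
    and \<xi>_indep: "prob_space.indep_vars M (\<lambda>_. borel) \<xi> {1..}"
    and \<xi>_distr: "\<forall>t\<ge>1. distr M borel (\<xi> t) = P"
    and f_diff: "\<forall>i\<le>m. \<forall>x\<in>X. f i differentiable (at x)"
    and M_pos: "M1 > 0" "M2 > 0"
    and moment_F: "\<forall>i\<le>m. \<forall>x\<in>X.
        (\<integral>\<^sup>+z\<in>\<Xi>. ennreal (exp ((F i x z - f i x)\<^sup>2 / M1\<^sup>2)) \<partial>P) \<le> ennreal (exp 1)"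
    and moment_L: "\<forall>x\<in>X.
        (\<integral>\<^sup>+z\<in>\<Xi>. ennreal (exp ((subgrad_dev nrm P F m x z)\<^sup>2 / M2\<^sup>2)) \<partial>P) \<le> ennreal (exp 1)"
    and feasible: "\<exists>x\<in>X. \<forall>i\<in>{1..m}. f i x \<le> 0"
    and N: "N > 0"
    and s: "s > 1"
    and lam: "lam \<in> {0..2 * sqrt (tau_star * real N)}"
    and \<mu>: "\<mu> \<in> {0..2 * sqrt (tau_star * real N)}"
  shows
    (* F is only meaningful on \<Xi>, so the events are restricted to samples lying in \<Xi>;
       this discards a null set. As measure is 0 on non-measurable sets, measurability of the
       events is part of the claim. *)
    "{w \<in> space M. (\<forall>t\<in>{1..N}. \<xi> t w \<in> \<Xi>) \<and> OptN w > Opt + \<mu> * M1 / sqrt (real N)} \<in> sets M \<and>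
     \<P>(w in M. (\<forall>t\<in>{1..N}. \<xi> t w \<in> \<Xi>) \<and> OptN w > Opt + \<mu> * M1 / sqrt (real N))
       \<le> real m * exp (- (\<mu>\<^sup>2 / (4 * tau_star))) \<and>
     {w \<in> space M. (\<forall>t\<in>{1..N}. \<xi> t w \<in> \<Xi>) \<and>
        OptN w < Opt - (\<mu> * M1 + 2 * M2 * R * (\<Omega> / 2 * (1 + s\<^sup>2) + 2 * lam)) / sqrt (real N)} \<in> sets M \<and>
     \<P>(w in M. (\<forall>t\<in>{1..N}. \<xi> t w \<in> \<Xi>) \<and>
        OptN w < Opt - (\<mu> * M1 + 2 * M2 * R * (\<Omega> / 2 * (1 + s\<^sup>2) + 2 * lam)) / sqrt (real N))
       \<le> exp (- (\<mu>\<^sup>2 / (4 * tau_star)))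
          + 2 * (exp (- real N * (s\<^sup>2 - 1)) + exp (- (lam\<^sup>2 / (4 * tau_star))))"
proof -
  interpret M: prob_space M by fact
  interpret P: prob_space P by fact
  note nrm' = is_normD[OF nrm]
  have sP: "sets P = sets borel" by (rule P(2))
  have borelP: "g \<in> borel_measurable P \<longleftrightarrow> g \<in> borel_measurable borel" for g :: "real ^ 'k \<Rightarrow> 'c::topological_space"
    using measurable_cong_sets[OF sP refl] by blast
  have \<Xi>_closed: "closed \<Xi>" unfolding \<Xi>_def by (rule msupport_closed)
  then have \<Xi>[measurable]: "\<Xi> \<in> sets borel" by simp
  have AE\<Xi>: "AE z in P. z \<in> \<Xi>" unfolding \<Xi>_def by (rule AE_msupport[OF sP])
  have \<xi>[measurable]: "\<xi> t \<in> measurable M borel" if "1 \<le> t" for t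
    using \<xi>_indep that by (auto simp: M.indep_vars_def)
  have distr: "distr M borel (\<xi> t) = P" if "1 \<le> t" for t using \<xi>_distr that by simp
  have AE\<xi>: "AE w in M. \<forall>t\<in>{1..N}. Q (\<xi> t w)" if "AE z in P. Q z" for Q
  proof (intro AE_finite_allI)
    fix t assume "t \<in> {1..N}"
    then have t: "1 \<le> t" by simp
    have "AE z in distr M borel (\<xi> t). Q z" using that unfolding distr[OF t] .
    then show "AE w in M. Q (\<xi> t w)" by (rule AE_distrD[OF \<xi>[OF t]])
  qed simp

  \<comment> \<open>Setting the functions to zero off the support makes them convex in \<open>x\<close> for every \<open>z\<close> and measurable on the whole space, and changes them only on a null set.\<close>
  define G where "G = (\<lambda>i x z. indicator \<Xi> z * F i x z)"
  have GF: "z \<in> \<Xi> \<Longrightarrow> G i x z = F i x z" for i x z by (simp add: G_def)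
  have G_convex: "convex_on UNIV (\<lambda>x. G i x z)" if "i \<le> m" for i z
  proof (cases "z \<in> \<Xi>")
    case True
    then show ?thesis using F_convex that by (simp add: G_def)
  qed (simp add: G_def convex_on_const)
  have G_int: "integrable P (G i x)" if "i \<le> m" for i x
    using F_summable that by (simp add: set_integrable_def G_def)
  have f_G: "f i = (\<lambda>x. integral\<^sup>L P (G i x))" for i
    by (simp add: fun_eq_iff f_def mean_fun_def set_lebesgue_integral_def G_def \<Xi>_def)
  have G_meas: "G i x \<in> borel_measurable borel" if "i \<le> m" for i x
    using borel_measurable_integrable[OF G_int[OF that]] by (simp add: borelP)
  have f_convex: "convex_on UNIV (f i)" if i: "i \<le> m" for i
    unfolding f_G
  proof (rule convex_onI)
    fix t :: real and x y :: 'a assume t: "0 < t" "t < 1"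
    have "integral\<^sup>L P (G i ((1 - t) *\<^sub>R x + t *\<^sub>R y)) \<le> (\<integral>z. (1 - t) * G i x z + t * G i y z \<partial>P)"
      using t convex_onD[OF G_convex[OF i], of t] G_int[OF i] by (intro integral_mono) auto
    also have "\<dots> = (1 - t) * integral\<^sup>L P (G i x) + t * integral\<^sup>L P (G i y)"
      using G_int[OF i] by simp
    finally show "integral\<^sup>L P (G i ((1 - t) *\<^sub>R x + t *\<^sub>R y))
        \<le> (1 - t) * integral\<^sup>L P (G i x) + t * integral\<^sup>L P (G i y)" .
  qed simp
  have f_cont: "continuous_on X (f i)" if "i \<in> {1..m}" for i
    using convex_on_continuous[OF open_UNIV f_convex[of i]] that continuous_on_subset by auto
  have saa_cont: "continuous_on X (saa_fun G N zs i)" if "i \<in> {1..m}" for i zs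
  proof -
    have "continuous_on X (\<lambda>x. G i x z)" for z
      using convex_on_continuous[OF open_UNIV G_convex[of i z]] that continuous_on_subset by auto
    then have "continuous_on X (\<lambda>x. (\<Sum>t=1..N. G i x (zs t)) / real N)"
      using N by (intro continuous_intros) auto
    then show ?thesis by (simp add: saa_fun_def[abs_def])
  qed
  define V where "V w = minimax_value X m (saa_fun G N (\<lambda>t. \<xi> t w))" for w
  have saa_meas: "(\<lambda>w. saa_fun G N (\<lambda>t. \<xi> t w) i x) \<in> borel_measurable M" if "i \<in> {1..m}" for i x
  proof -
    have "(\<lambda>w. G i x (\<xi> t w)) \<in> borel_measurable M" if "t \<in> {1..N}" for t
      using measurable_compose[OF \<xi> G_meas] that \<open>i \<in> {1..m}\<close> by simp
    then show ?thesis unfolding saa_fun_def by (intro borel_measurable_divide borel_measurable_sum) auto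
  qed
  have [measurable]: "V \<in> borel_measurable M"
    unfolding V_def using saa_cont saa_meas by (intro minimax_value_measurable X m) auto
  have V_OptN: "OptN w = V w" if w: "\<forall>t\<in>{1..N}. \<xi> t w \<in> \<Xi>" for w
  proof -
    have "saa_fun F N (\<lambda>t. \<xi> t w) = saa_fun G N (\<lambda>t. \<xi> t w)"
      using w by (auto simp: fun_eq_iff saa_fun_def GF intro!: sum.cong)
    then show ?thesis by (simp add: OptN_def V_def)
  qed
  have pred_\<Xi>: "Measurable.pred M (\<lambda>w. \<xi> t w \<in> \<Xi>)" if "t \<in> {1..N}" for t
  proof -
    have "\<xi> t \<in> measurable M borel" using \<xi> that by simp
    from pred_sets2[OF \<Xi> this] show ?thesis .
  qed
  have in_\<Xi>[measurable]: "Measurable.pred M (\<lambda>w. \<forall>t\<in>{1..N}. \<xi> t w \<in> \<Xi>)"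
    using pred_intros_finite(3)[where P = "\<lambda>w t. \<xi> t w \<in> \<Xi>", OF finite_atLeastAtMost pred_\<Xi>] .

  obtain xs where xs: "xs \<in> X" and Opt_xs: "Opt = (MAX i\<in>{1..m}. f i xs)"
    and Opt_le: "\<And>u. u \<in> X \<Longrightarrow> Opt \<le> (MAX i\<in>{1..m}. f i u)"
    unfolding Opt_def f_def[symmetric] by (rule minimax_value_attained[where \<Phi> = f, OF X(3,1) m f_cont]) auto
  have ne: "{1..m} \<noteq> {}" using m by simp
  define \<mu>M where "\<mu>M = \<mu> * M1 * sqrt (real N)"
  have sq: "sqrt (real N) > 0" using N by simp
  have sqN: "c * sqrt (real N) / real N = c / sqrt (real N)" for c
  proof -
    have "c * sqrt (real N) / real N = c * sqrt (real N) / (sqrt (real N) * sqrt (real N))" by simp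
    also have "\<dots> = c / sqrt (real N)" by (rule nonzero_mult_divide_mult_cancel_right) (use sq in simp)
    finally show ?thesis .
  qed

  have momF: "(\<integral>\<^sup>+z. ennreal (exp ((G i xs z - f i xs)\<^sup>2 / M1\<^sup>2)) \<partial>P) \<le> ennreal (exp 1)" if "i \<le> m" for i
  proof -
    have "(\<integral>\<^sup>+z. ennreal (exp ((G i xs z - f i xs)\<^sup>2 / M1\<^sup>2)) \<partial>P)
        \<le> (\<integral>\<^sup>+z\<in>\<Xi>. ennreal (exp ((F i xs z - f i xs)\<^sup>2 / M1\<^sup>2)) \<partial>P)"
      by (rule nn_integral_mono_AE) (use AE\<Xi> in eventually_elim, simp add: GF)
    also have "\<dots> \<le> ennreal (exp 1)" using moment_F that xs by blast
    finally show ?thesis .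
  qed

  \<comment> \<open>If the optimal value is too large, then so is one of the empirical means at \<open>xs\<close>.\<close>
  define U where "U i = {w \<in> space M. \<mu>M < (\<Sum>t=1..N. G i xs (\<xi> t w) - f i xs)}" for i
  have U_sets: "U i \<in> sets M" if "i \<in> {1..m}" for i
  proof -
    have "(\<lambda>w. G i xs (\<xi> t w)) \<in> borel_measurable M" if "t \<in> {1..N}" for t
      using measurable_compose[OF \<xi> G_meas] that \<open>i \<in> {1..m}\<close> by simp
    then have "(\<lambda>w. \<Sum>t=1..N. G i xs (\<xi> t w) - f i xs) \<in> borel_measurable M"
      by (intro borel_measurable_sum borel_measurable_diff) auto
    then show ?thesis unfolding U_def by measurable
  qed
  have U_prob: "M.prob (U i) \<le> exp (- (\<mu>\<^sup>2 / (4 * tau_star)))" if i: "i \<in> {1..m}" for i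
  proof -
    have int: "integrable P (G i xs)" using G_int i by simp
    show ?thesis
      unfolding U_def \<mu>M_def
      by (rule M.iid_sum_tail[OF P(1) \<xi>_indep distr _ _ momF M_pos(1) N \<mu>])
        (use int i in \<open>simp_all add: f_G P.prob_space\<close>)
  qed
  define Hi where "Hi = {w \<in> space M. (\<forall>t\<in>{1..N}. \<xi> t w \<in> \<Xi>) \<and> OptN w > Opt + \<mu> * M1 / sqrt (real N)}"
  have Hi_V: "Hi = {w \<in> space M. (\<forall>t\<in>{1..N}. \<xi> t w \<in> \<Xi>) \<and> V w > Opt + \<mu> * M1 / sqrt (real N)}"
    unfolding Hi_def using V_OptN by (auto simp del: atLeastAtMost_iff)
  have Hi_sets: "Hi \<in> sets M" unfolding Hi_V by measurable
  have "Hi \<subseteq> (\<Union>i\<in>{1..m}. U i)"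
  proof
    fix w assume "w \<in> Hi"
    then have w: "w \<in> space M" "Opt + \<mu> * M1 / sqrt (real N) < V w" by (auto simp: Hi_V)
    have "V w \<le> (MAX i\<in>{1..m}. saa_fun G N (\<lambda>t. \<xi> t w) i xs)"
      unfolding V_def 
      by (rule minimax_value_attained[where \<Phi> = "saa_fun G N (\<lambda>t. \<xi> t w)", OF X(3,1) m saa_cont]) (use xs in auto)
    moreover have "(MAX i\<in>{1..m}. saa_fun G N (\<lambda>t. \<xi> t w) i xs) \<in> (\<lambda>i. saa_fun G N (\<lambda>t. \<xi> t w) i xs) ` {1..m}"
      using ne by (intro Max_in) auto
    ultimately obtain i where i: "i \<in> {1..m}" "V w \<le> saa_fun G N (\<lambda>t. \<xi> t w) i xs" by auto
    have "f i xs \<le> Opt" unfolding Opt_xs using i(1) by (intro Max_ge) auto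
    with w(2) i(2) have "f i xs + \<mu>M / real N < saa_fun G N (\<lambda>t. \<xi> t w) i xs"
      unfolding \<mu>M_def sqN by linarith
    then have "(real N * f i xs + \<mu>M) / real N < (\<Sum>t=1..N. G i xs (\<xi> t w)) / real N"
      using N by (simp add: saa_fun_def add_divide_distrib)
    then have "real N * f i xs + \<mu>M < (\<Sum>t=1..N. G i xs (\<xi> t w))"
      using N by (simp add: divide_less_cancel)
    then have "\<mu>M < (\<Sum>t=1..N. G i xs (\<xi> t w) - f i xs)" by (simp add: sum_subtractf)
    then show "w \<in> (\<Union>i\<in>{1..m}. U i)" using w(1) i(1) by (auto simp: U_def)
  qed
  then have "M.prob Hi \<le> M.prob (\<Union>i\<in>{1..m}. U i)"
    using U_sets by (intro M.finite_measure_mono) auto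
  also have "\<dots> \<le> (\<Sum>i\<in>{1..m}. M.prob (U i))" by (rule measure_UNION_le) (use U_sets in auto)
  also have "\<dots> \<le> (\<Sum>i\<in>{1..m}. exp (- (\<mu>\<^sup>2 / (4 * tau_star))))" by (intro sum_mono U_prob)
  finally have Hi_prob: "M.prob Hi \<le> real m * exp (- (\<mu>\<^sup>2 / (4 * tau_star)))" by simp

  \<comment> \<open>The weights \<open>y\<close> reduce the maximum to one convex function that is stationary at \<open>xs\<close>.\<close>
  have "\<forall>i\<in>{1..m}. \<exists>h. (f i has_derivative (\<lambda>d. inner h d)) (at xs)"
  proof
    fix i assume "i \<in> {1..m}"
    then have "f i differentiable (at xs)" using f_diff xs by simp
    then show "\<exists>h. (f i has_derivative (\<lambda>d. inner h d)) (at xs)" by (rule differentiable_gradient) blast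
  qed
  then obtain h where h: "\<And>i. i \<in> {1..m} \<Longrightarrow> (f i has_derivative (\<lambda>d. inner (h i) d)) (at xs)" by metis
  obtain y where y: "\<And>i. 0 \<le> y i" "sum y {1..m} = 1"
    "(\<Sum>i=1..m. y i * f i xs) = Opt"
    "\<And>u. u \<in> X \<Longrightarrow> 0 \<le> inner (\<Sum>i=1..m. y i *\<^sub>R h i) (u - xs)"
    by (rule minimax_multipliers[where f = f and h = h, OF X(2) xs finite_atLeastAtMost ne Opt_le[unfolded Opt_xs] h]) (auto simp: Opt_xs)
  have "\<forall>i\<in>{1..m}. \<exists>g. g \<in> borel_measurable P \<and> (AE z in P. g z \<in> subdiff (\<lambda>y. G i y z) xs) \<and>
    (\<forall>d. integrable P (\<lambda>z. inner (g z) d)) \<and> (\<forall>d. (\<integral>z. inner (g z) d \<partial>P) = inner (h i) d)"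
  proof
    fix i assume i: "i \<in> {1..m}"
    then have "i \<le> m" by simp
    show "\<exists>g. g \<in> borel_measurable P \<and> (AE z in P. g z \<in> subdiff (\<lambda>y. G i y z) xs) \<and>
      (\<forall>d. integrable P (\<lambda>z. inner (g z) d)) \<and> (\<forall>d. (\<integral>z. inner (g z) d \<partial>P) = inner (h i) d)"
    proof (rule AE_gradient[OF G_convex[OF \<open>i \<le> m\<close>] G_int[OF \<open>i \<le> m\<close>] h[OF i, unfolded f_G]])
      fix g assume "g \<in> borel_measurable P" "AE z in P. g z \<in> subdiff (\<lambda>y. G i y z) xs"
        "\<And>d. integrable P (\<lambda>z. inner (g z) d)" "\<And>d. (\<integral>z. inner (g z) d \<partial>P) = inner (h i) d"
      then show ?thesis by (intro exI[of _ g] conjI allI)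
    qed
  qed
  from bchoice[OF this] obtain g where g0: "\<forall>i\<in>{1..m}. g i \<in> borel_measurable P \<and>
    (AE z in P. g i z \<in> subdiff (\<lambda>y. G i y z) xs) \<and>
    (\<forall>d. integrable P (\<lambda>z. inner (g i z) d)) \<and> (\<forall>d. (\<integral>z. inner (g i z) d \<partial>P) = inner (h i) d)"
    by (rule exE)
  then have g: "\<And>i. i \<in> {1..m} \<Longrightarrow> g i \<in> borel_measurable P"
    "\<And>i. i \<in> {1..m} \<Longrightarrow> AE z in P. g i z \<in> subdiff (\<lambda>y. G i y z) xs"
    "\<And>i d. i \<in> {1..m} \<Longrightarrow> integrable P (\<lambda>z. inner (g i z) d)"
    "\<And>i d. i \<in> {1..m} \<Longrightarrow> (\<integral>z. inner (g i z) d \<partial>P) = inner (h i) d" by blast+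
  \<comment> \<open>The signs are chosen such that the optimal value drops when \<open>\<eta>\<close> and \<open>\<zeta>\<close> are large.\<close>
  define \<eta> where "\<eta> z = (\<Sum>i=1..m. y i *\<^sub>R (h i - g i z))" for z
  define \<zeta> where "\<zeta> z = (\<Sum>i=1..m. y i * (f i xs - G i xs z))" for z
  have \<eta>_meas: "\<eta> \<in> borel_measurable borel"
    unfolding \<eta>_def using g(1) by (intro borel_measurable_sum borel_measurable_scaleR borel_measurable_diff) (auto simp: borelP)
  have \<eta>_inner: "inner (\<eta> z) u = (\<Sum>i=1..m. y i * (inner (h i) u - inner (g i z) u))" for z u
    by (simp add: \<eta>_def inner_sum_left inner_diff_left)
  have \<eta>_int: "integrable P (\<lambda>z. inner (\<eta> z) u)" for u
    unfolding \<eta>_inner using g(3) by (intro Bochner_Integration.integrable_sum) auto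
  have \<eta>_mean: "(\<integral>z. inner (\<eta> z) u \<partial>P) = 0" for u
    unfolding \<eta>_inner using g(3,4) by (subst Bochner_Integration.integral_sum) (auto simp: P.prob_space intro!: sum.neutral)
  have AEg: "AE z in P. \<forall>i\<in>{1..m}. g i z \<in> subdiff (\<lambda>y. G i y z) xs"
    using g(2) by (intro AE_finite_allI) auto
  \<comment> \<open>As \<open>y\<close> is a convex combination, the conjugate norm of \<open>\<eta>\<close> inherits the bound on the single deviations. The integrals are compared by monotonicity, which holds even for integrands that are not known to be measurable.\<close>
  have \<eta>_mom: "(\<integral>\<^sup>+z. ennreal (exp ((dual_norm nrm (\<eta> z))\<^sup>2 / M2\<^sup>2)) \<partial>P) \<le> ennreal (exp 1)"
  proof -
    note nd = is_normD[OF is_norm_dual_norm[OF nrm]]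
    have "(\<integral>\<^sup>+z. ennreal (exp ((dual_norm nrm (\<eta> z))\<^sup>2 / M2\<^sup>2)) \<partial>P)
        \<le> (\<integral>\<^sup>+z\<in>\<Xi>. ennreal (exp ((subgrad_dev nrm P F m xs z)\<^sup>2 / M2\<^sup>2)) \<partial>P)"
    proof (rule nn_integral_mono_AE)
      show "AE z in P. ennreal (exp ((dual_norm nrm (\<eta> z))\<^sup>2 / M2\<^sup>2))
          \<le> ennreal (exp ((subgrad_dev nrm P F m xs z)\<^sup>2 / M2\<^sup>2)) * indicator \<Xi> z"
        using AE\<Xi> AEg
      proof eventually_elim
        case (elim z)
        let ?L = "subgrad_dev nrm P F m xs z"
        have dev: "dual_norm nrm (h i - g i z) \<le> ?L" if i: "i \<in> {1..m}" for i
        proof -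
          have "g i z \<in> subdiff (\<lambda>y. F i y z) xs" using elim i by (simp add: GF)
          moreover have "h i \<in> subdiff (mean_fun P F i) xs"
            using derivative_in_subdiff[OF f_convex h[OF i]] i by (simp add: f_def)
          ultimately have "dual_norm nrm (g i z - h i) \<le> ?L"
            using i by (intro dual_norm_le_subgrad_dev[OF nrm]) auto
          then show ?thesis by (simp add: nd(7)[of "h i"])
        qed
        have "dual_norm nrm (\<eta> z) \<le> (\<Sum>i=1..m. dual_norm nrm (y i *\<^sub>R (h i - g i z)))"
          unfolding \<eta>_def
          by (rule is_norm_sum[OF is_norm_dual_norm[OF nrm]])
        also have "\<dots> = (\<Sum>i=1..m. y i * dual_norm nrm (h i - g i z))" using y(1) by (simp add: nd(2))
        also have "\<dots> \<le> (\<Sum>i=1..m. y i * ?L)" using dev y(1) by (intro sum_mono mult_left_mono) auto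
        also have "\<dots> = ?L" using y(2) by (simp flip: sum_distrib_right)
        finally have "(dual_norm nrm (\<eta> z))\<^sup>2 \<le> ?L\<^sup>2" by (intro power_mono nd)
        then show ?case using elim by (auto intro!: ennreal_leI divide_right_mono)
      qed
    qed
    also have "\<dots> \<le> ennreal (exp 1)" using moment_L xs by blast
    finally show ?thesis .
  qed
  have \<zeta>_int: "integrable P \<zeta>"
    unfolding \<zeta>_def using G_int by (intro Bochner_Integration.integrable_sum) auto
  have \<zeta>_mean: "integral\<^sup>L P \<zeta> = 0"
  proof -
    have "integral\<^sup>L P \<zeta> = (\<Sum>i=1..m. \<integral>z. y i * (f i xs - G i xs z) \<partial>P)"
      unfolding \<zeta>_def using G_int by (intro Bochner_Integration.integral_sum) auto
    also have "\<dots> = 0" using G_int by (intro sum.neutral) (auto simp: f_G P.prob_space)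
    finally show ?thesis .
  qed
  have \<zeta>_mom: "(\<integral>\<^sup>+z. ennreal (exp ((\<zeta> z)\<^sup>2 / M1\<^sup>2)) \<partial>P) \<le> ennreal (exp 1)"
  proof -
    have pt: "exp ((\<zeta> z)\<^sup>2 / M1\<^sup>2) \<le> (\<Sum>i=1..m. y i * exp ((G i xs z - f i xs)\<^sup>2 / M1\<^sup>2))" for z
    proof -
      have "(\<zeta> z)\<^sup>2 \<le> (\<Sum>i=1..m. y i * (f i xs - G i xs z)\<^sup>2)"
        using convex_on_sum[OF _ ne convex_power2, of y "\<lambda>i. f i xs - G i xs z"] y by (simp add: \<zeta>_def)
      then have "(\<zeta> z)\<^sup>2 / M1\<^sup>2 \<le> (\<Sum>i=1..m. y i * (f i xs - G i xs z)\<^sup>2) / M1\<^sup>2"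
        by (rule divide_right_mono) simp
      also have "\<dots> = (\<Sum>i=1..m. y i * ((G i xs z - f i xs)\<^sup>2 / M1\<^sup>2))"
        by (simp add: sum_divide_distrib power2_commute)
      finally have "exp ((\<zeta> z)\<^sup>2 / M1\<^sup>2) \<le> exp (\<Sum>i=1..m. y i * ((G i xs z - f i xs)\<^sup>2 / M1\<^sup>2))" by simp
      also have "\<dots> \<le> (\<Sum>i=1..m. y i * exp ((G i xs z - f i xs)\<^sup>2 / M1\<^sup>2))"
        using convex_on_sum[OF _ ne exp_convex, of y "\<lambda>i. (G i xs z - f i xs)\<^sup>2 / M1\<^sup>2"] y by simp
      finally show ?thesis .
    qed
    have "(\<integral>\<^sup>+z. ennreal (exp ((\<zeta> z)\<^sup>2 / M1\<^sup>2)) \<partial>P)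
        \<le> (\<integral>\<^sup>+z. (\<Sum>i=1..m. ennreal (y i) * ennreal (exp ((G i xs z - f i xs)\<^sup>2 / M1\<^sup>2))) \<partial>P)"
    proof (rule nn_integral_mono)
      fix z
      have "ennreal (exp ((\<zeta> z)\<^sup>2 / M1\<^sup>2)) \<le> ennreal (\<Sum>i=1..m. y i * exp ((G i xs z - f i xs)\<^sup>2 / M1\<^sup>2))"
        by (rule ennreal_leI[OF pt])
      then show "ennreal (exp ((\<zeta> z)\<^sup>2 / M1\<^sup>2)) \<le> (\<Sum>i=1..m. ennreal (y i) * ennreal (exp ((G i xs z - f i xs)\<^sup>2 / M1\<^sup>2)))"
        using y(1) by (simp add: sum_ennreal[symmetric] ennreal_mult)
    qed
    also have "\<dots> = (\<Sum>i=1..m. ennreal (y i) * (\<integral>\<^sup>+z. ennreal (exp ((G i xs z - f i xs)\<^sup>2 / M1\<^sup>2)) \<partial>P))"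
    proof -
      have Gm: "(\<lambda>z. ennreal (exp ((G i xs z - f i xs)\<^sup>2 / M1\<^sup>2))) \<in> borel_measurable P" if "i \<in> {1..m}" for i
      proof -
        have [measurable]: "G i xs \<in> borel_measurable P" using G_int that by (intro borel_measurable_integrable) auto
        show ?thesis by measurable
      qed
      then show ?thesis by (subst nn_integral_sum) (auto intro!: sum.cong nn_integral_cmult)
    qed
    also have "\<dots> \<le> (\<Sum>i=1..m. ennreal (y i) * ennreal (exp 1))"
      by (intro sum_mono mult_left_mono momF) auto
    also have "\<dots> = ennreal (\<Sum>i=1..m. y i * exp 1)"
      using y(1) by (simp add: sum_ennreal[symmetric] ennreal_mult)
    also have "(\<Sum>i=1..m. y i * exp 1) = exp 1" using y(2) by (simp flip: sum_distrib_right)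
    finally show ?thesis .
  qed
  define D where "D = M2 * sqrt (real N) * (\<Omega> / 2 * (1 + s\<^sup>2) + lam)"
  define E1 where "E1 = {w \<in> space M. \<mu>M < (\<Sum>t=1..N. \<zeta> (\<xi> t w))}"
  define E2 where "E2 = {w \<in> space M. D < dual_norm nrm (\<Sum>t=1..N. \<eta> (\<xi> t w))}"
  have E1_sets: "E1 \<in> sets M"
  proof -
    have "\<zeta> \<in> borel_measurable borel" using borel_measurable_integrable[OF \<zeta>_int] by (simp add: borelP)
    then have "(\<lambda>w. \<Sum>t=1..N. \<zeta> (\<xi> t w)) \<in> borel_measurable M"
      by (intro borel_measurable_sum measurable_compose[OF \<xi>]) auto
    then show ?thesis unfolding E1_def by measurable
  qed
  have E2_sets: "E2 \<in> sets M"
  proof -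
    have [measurable]: "dual_norm nrm \<in> borel_measurable borel"
      by (intro borel_measurable_continuous_onI is_norm_continuous is_norm_dual_norm nrm)
    have [measurable]: "(\<lambda>w. \<Sum>t=1..N. \<eta> (\<xi> t w)) \<in> borel_measurable M"
      using \<eta>_meas by (intro borel_measurable_sum measurable_compose[OF \<xi>]) auto
    show ?thesis unfolding E2_def by measurable
  qed
  have E1_prob: "M.prob E1 \<le> exp (- (\<mu>\<^sup>2 / (4 * tau_star)))"
    unfolding E1_def \<mu>M_def by (rule M.iid_sum_tail[OF P(1) \<xi>_indep distr \<zeta>_int \<zeta>_mean \<zeta>_mom M_pos(1) N \<mu>])
  have E2_prob: "M.prob E2 \<le> exp (- real N * (s\<^sup>2 - 1)) + exp (- (lam\<^sup>2 / (4 * tau_star)))"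
    unfolding E2_def D_def \<Omega>_def
    by (rule M.dual_norm_sum_tail[OF nrm \<omega>_deriv \<omega>_strongly_convex \<omega>_0 P(1) \<xi>_indep distr
        \<eta>_meas \<eta>_int \<eta>_mean \<eta>_mom M_pos(2) N lam])
  obtain c where c: "X \<subseteq> norm_ball nrm c R"
    unfolding R_def using min_radius_attained[OF nrm X(3,1)] by blast
  have R0: "0 \<le> R" using c xs nrm'(8)[of "xs - c"] by (force simp: norm_ball_def)
  have diam: "nrm (u - xs) \<le> 2 * R" if "u \<in> X" for u
  proof -
    have "nrm (u - c) \<le> R" "nrm (xs - c) \<le> R" using c that xs by (auto simp: norm_ball_def)
    then show ?thesis using nrm'(6)[of "u - c" "xs - c"] by simp
  qed
  define Lo where "Lo = {w \<in> space M. (\<forall>t\<in>{1..N}. \<xi> t w \<in> \<Xi>) \<and>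
        OptN w < Opt - (\<mu> * M1 + 2 * M2 * R * (\<Omega> / 2 * (1 + s\<^sup>2) + 2 * lam)) / sqrt (real N)}"
  have Lo_V: "Lo = {w \<in> space M. (\<forall>t\<in>{1..N}. \<xi> t w \<in> \<Xi>) \<and>
        V w < Opt - (\<mu> * M1 + 2 * M2 * R * (\<Omega> / 2 * (1 + s\<^sup>2) + 2 * lam)) / sqrt (real N)}"
    unfolding Lo_def using V_OptN by (auto simp del: atLeastAtMost_iff)
  have Lo_sets: "Lo \<in> sets M" unfolding Lo_V by measurable
  \<comment> \<open>Averaging with \<open>y\<close> bounds the maximum from below; linearisation at \<open>xs\<close> and stationarity leave only the two fluctuations.\<close>
  have V_lower: "Opt - ((\<Sum>t=1..N. \<zeta> (\<xi> t w)) + 2 * R * dual_norm nrm (\<Sum>t=1..N. \<eta> (\<xi> t w))) / real N \<le> V w"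
    if sub: "\<forall>t\<in>{1..N}. \<forall>i\<in>{1..m}. g i (\<xi> t w) \<in> subdiff (\<lambda>y. G i y (\<xi> t w)) xs" for w
    unfolding V_def minimax_value_def
  proof (rule cINF_greatest[OF X(1)])
    fix x assume x: "x \<in> X"
    define Z H where "Z = (\<Sum>t=1..N. \<zeta> (\<xi> t w))" and "H = (\<Sum>t=1..N. \<eta> (\<xi> t w))"
    have step: "Opt - \<zeta> (\<xi> t w) - inner (\<eta> (\<xi> t w)) (x - xs) \<le> (\<Sum>i=1..m. y i * G i x (\<xi> t w))"
      if t: "t \<in> {1..N}" for t
    proof -
      have "(\<Sum>i=1..m. y i * (G i xs (\<xi> t w) + inner (g i (\<xi> t w)) (x - xs))) \<le> (\<Sum>i=1..m. y i * G i x (\<xi> t w))"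
        using sub t y(1) by (intro sum_mono mult_left_mono) (auto simp: subdiff_def)
      moreover have "(\<Sum>i=1..m. y i * (G i xs (\<xi> t w) + inner (g i (\<xi> t w)) (x - xs)))
          = (\<Sum>i=1..m. y i * f i xs) - \<zeta> (\<xi> t w) + inner (\<Sum>i=1..m. y i *\<^sub>R h i) (x - xs) - inner (\<eta> (\<xi> t w)) (x - xs)"
        by (simp add: \<zeta>_def \<eta>_def inner_sum_left inner_diff_left algebra_simps sum.distrib sum_subtractf)
      ultimately show ?thesis using y(3) y(4)[OF x] by linarith
    qed
    have "inner H (x - xs) \<le> nrm (x - xs) * dual_norm nrm H"
      using inner_le_dual_norm[OF nrm, of "x - xs" H] by (simp add: inner_commute)
    also have "\<dots> \<le> 2 * R * dual_norm nrm H"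
      by (intro mult_right_mono diam x dual_norm_nonneg nrm)
    finally have HR: "inner H (x - xs) \<le> 2 * R * dual_norm nrm H" .
    have "real N * Opt - Z - inner H (x - xs) = (\<Sum>t=1..N. Opt - \<zeta> (\<xi> t w) - inner (\<eta> (\<xi> t w)) (x - xs))"
      by (simp add: Z_def H_def sum_subtractf inner_sum_left)
    also have "\<dots> \<le> (\<Sum>t=1..N. \<Sum>i=1..m. y i * G i x (\<xi> t w))" by (intro sum_mono step)
    also have "\<dots> = (\<Sum>i=1..m. y i * (\<Sum>t=1..N. G i x (\<xi> t w)))"
      by (subst sum.swap) (simp add: sum_distrib_left)
    also have "\<dots> = (\<Sum>i=1..m. y i * (real N * saa_fun G N (\<lambda>t. \<xi> t w) i x))"
      using N by (simp add: saa_fun_def)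
    also have "\<dots> \<le> (\<Sum>i=1..m. y i * (real N * (MAX i\<in>{1..m}. saa_fun G N (\<lambda>t. \<xi> t w) i x)))"
      using y(1) by (intro sum_mono mult_left_mono Max_ge) auto
    also have "\<dots> = real N * (MAX i\<in>{1..m}. saa_fun G N (\<lambda>t. \<xi> t w) i x)"
      using y(2) by (simp flip: sum_distrib_right)
    finally have "(real N * Opt - (Z + 2 * R * dual_norm nrm H)) / real N
        \<le> (real N * (MAX i\<in>{1..m}. saa_fun G N (\<lambda>t. \<xi> t w) i x)) / real N"
      using HR by (intro divide_right_mono) linarith+
    then show "Opt - (Z + 2 * R * dual_norm nrm H) / real N \<le> (MAX i\<in>{1..m}. saa_fun G N (\<lambda>t. \<xi> t w) i x)"
      using N by (simp add: diff_divide_distrib)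
  qed
  have "AE w in M. w \<in> Lo \<longrightarrow> w \<in> E1 \<union> E2"
    using AE\<xi>[OF AEg]
  proof eventually_elim
    case (elim w)
    show ?case
    proof (intro impI, rule ccontr)
      assume w: "w \<in> Lo" "w \<notin> E1 \<union> E2"
      then have Z: "(\<Sum>t=1..N. \<zeta> (\<xi> t w)) \<le> \<mu>M" and H: "dual_norm nrm (\<Sum>t=1..N. \<eta> (\<xi> t w)) \<le> D"
        by (auto simp: Lo_def E1_def E2_def)
      have "2 * R * dual_norm nrm (\<Sum>t=1..N. \<eta> (\<xi> t w)) \<le> 2 * R * D"
        using H R0 by (intro mult_left_mono) auto
      then have "((\<Sum>t=1..N. \<zeta> (\<xi> t w)) + 2 * R * dual_norm nrm (\<Sum>t=1..N. \<eta> (\<xi> t w))) / real N \<le> (\<mu>M + 2 * R * D) / real N"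
        using Z by (intro divide_right_mono) auto
      also have "\<mu>M + 2 * R * D = (\<mu> * M1 + 2 * M2 * R * (\<Omega> / 2 * (1 + s\<^sup>2) + lam)) * sqrt (real N)"
        by (simp add: \<mu>M_def D_def algebra_simps)
      also have "\<dots> / real N = (\<mu> * M1 + 2 * M2 * R * (\<Omega> / 2 * (1 + s\<^sup>2) + lam)) / sqrt (real N)" by (rule sqN)
      also have "\<dots> \<le> (\<mu> * M1 + 2 * M2 * R * (\<Omega> / 2 * (1 + s\<^sup>2) + 2 * lam)) / sqrt (real N)"
        using M_pos R0 lam sq by (intro divide_right_mono add_left_mono mult_left_mono) auto
      finally have "Opt - (\<mu> * M1 + 2 * M2 * R * (\<Omega> / 2 * (1 + s\<^sup>2) + 2 * lam)) / sqrt (real N) \<le> V w"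
        using V_lower[OF elim] by linarith
      then show False using w(1) by (simp add: Lo_V)
    qed
  qed
  then have "M.prob Lo \<le> M.prob (E1 \<union> E2)"
    by (rule M.finite_measure_mono_AE) (use E1_sets E2_sets in auto)
  also have "\<dots> \<le> M.prob E1 + M.prob E2" by (rule measure_Un_le[OF E1_sets E2_sets])
  finally have Lo_E: "M.prob Lo \<le> M.prob E1 + M.prob E2" .
  have slack: "p \<le> a + 2 * (b + d)" if "p \<le> p1 + p2" "p1 \<le> a" "p2 \<le> b + d" "0 \<le> b" "0 \<le> d"
    for p p1 p2 a b d :: real using that unfolding distrib_left by linarith
  have Lo_prob: "M.prob Lo \<le> exp (- (\<mu>\<^sup>2 / (4 * tau_star)))
      + 2 * (exp (- real N * (s\<^sup>2 - 1)) + exp (- (lam\<^sup>2 / (4 * tau_star))))"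
    by (rule slack[OF Lo_E E1_prob E2_prob exp_ge_zero exp_ge_zero])
  show ?thesis
    using Hi_sets Hi_prob Lo_sets Lo_prob unfolding Hi_def Lo_def by blast
qed

end
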